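(* Let $X$ be a separable metrizable space. Then: (i) $B_1(X)$ is Polish if and only if $X$ is countable; (ii) $B_1(X)$ is complete (that is, $B_1(X)=\mathbb{R}^X$) if and only if $X$ is a $Q$-set; (iii) $B_1(X)$ is sequentially complete if and only if $X$ is a $\sigma$-set; (iv) $B_1(X)$ is a Choquet space if and only if $X$ is a $\lambda$-set; (v) $B_1(X)$ is a Baire space if and only if $X$ is a $\kappa$-set.
   Context: $B_1(X)$ is the space of all functions $f:X\to\mathbb{R}$ that are pointwise limits of sequences of continuous real-valued functions on $X$, a real locally convex space with the pointwise topology (subspace topology from $\mathbb{R}^X$). A locally convex space is complete if each Cauchy net in it converges, and sequentially complete if each Cauchy sequence in it converges. Polish means separable and completely metrizable. A separable metrizable space $X$ is: a $Q$-set if each subset of $X$ is a $G_\delta$-set; a $\sigma$-set if each $F_\sigma$-subset of $X$ is a $G_\delta$-set; a $\lambda$-set if each countable subset of $X$ is a $G_\delta$-set; a $\kappa$-set if for every pairwise disjoint sequence $\{M_n\}_{n\in\omega}$ of finite subsets of $X$ there exists an infinite $A\subseteq\omega$ such that $\bigcup_{n\in A}M_n$ is a $G_\delta$-set in $X$. A nonempty topological space $Y$ is a Choquet space if the second player (Nonempty) has a winning strategy in the Choquet game on $Y$: players Empty and Nonempty alternately choose nonempty open sets $U_0\supseteq V_0\supseteq U_1\supseteq V_1\supseteq\cdots$ (Empty chooses $U_n$, Nonempty chooses $V_n$), and Nonempty wins if $\bigcap_n V_n\neq\emptyset$. A space is Baire if the intersection of countably many dense open subsets is dense. *)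

theory Defs
  imports "HOL-Analysis.Analysis"
begin

section \<open>Special subsets of separable metrizable spaces\<close>

definition Q_set :: "'a topology \<Rightarrow> bool" where
  "Q_set X \<longleftrightarrow> (\<forall>S. S \<subseteq> topspace X \<longrightarrow> gdelta_in X S)"

definition sigma_set :: "'a topology \<Rightarrow> bool" where
  "sigma_set X \<longleftrightarrow> (\<forall>S. fsigma_in X S \<longrightarrow> gdelta_in X S)"

definition lambda_set :: "'a topology \<Rightarrow> bool" where
  "lambda_set X \<longleftrightarrow> (\<forall>S. S \<subseteq> topspace X \<and> countable S \<longrightarrow> gdelta_in X S)"

definition kappa_set :: "'a topology \<Rightarrow> bool" where
  "kappa_set X \<longleftrightarrow>
     (\<forall>M :: nat \<Rightarrow> 'a set.
        (\<forall>n. finite (M n) \<and> M n \<subseteq> topspace X) \<and> disjoint_family M \<longrightarrow>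
        (\<exists>A. infinite A \<and> gdelta_in X (\<Union>n\<in>A. M n)))"

section \<open>Polish, Choquet and Baire spaces\<close>

definition Polish_space :: "'a topology \<Rightarrow> bool" where
  "Polish_space Y \<longleftrightarrow> separable_space Y \<and> completely_metrizable_space Y"

text \<open>
  A strategy \<open>\<sigma>\<close> of Nonempty maps the list of the moves \<open>U\<^sub>0, \<dots>, U\<^sub>n\<close> made so far by Empty to
  the reply \<open>V\<^sub>n\<close>; the earlier replies of Nonempty are determined by \<open>\<sigma>\<close> and this list.
\<close>

definition strategy_reply :: "('a set list \<Rightarrow> 'a set) \<Rightarrow> (nat \<Rightarrow> 'a set) \<Rightarrow> nat \<Rightarrow> 'a set" where
  "strategy_reply \<sigma> U n = \<sigma> (map U [0..<Suc n])"

definition legal_Empty_move ::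
    "'a topology \<Rightarrow> ('a set list \<Rightarrow> 'a set) \<Rightarrow> (nat \<Rightarrow> 'a set) \<Rightarrow> nat \<Rightarrow> bool" where
  "legal_Empty_move Y \<sigma> U n \<longleftrightarrow>
     openin Y (U n) \<and> U n \<noteq> {} \<and> (\<forall>m. n = Suc m \<longrightarrow> U n \<subseteq> strategy_reply \<sigma> U m)"

definition winning_strategy_Nonempty :: "'a topology \<Rightarrow> ('a set list \<Rightarrow> 'a set) \<Rightarrow> bool" where
  "winning_strategy_Nonempty Y \<sigma> \<longleftrightarrow>
     (\<forall>U.
        (\<forall>n. (\<forall>k\<le>n. legal_Empty_move Y \<sigma> U k) \<longrightarrow>
               openin Y (strategy_reply \<sigma> U n) \<and> strategy_reply \<sigma> U n \<noteq> {} \<and>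
               strategy_reply \<sigma> U n \<subseteq> U n) \<and>
        ((\<forall>n. legal_Empty_move Y \<sigma> U n) \<longrightarrow> (\<Inter>n. strategy_reply \<sigma> U n) \<noteq> {}))"

definition Choquet_space :: "'a topology \<Rightarrow> bool" where
  "Choquet_space Y \<longleftrightarrow> topspace Y \<noteq> {} \<and> (\<exists>\<sigma>. winning_strategy_Nonempty Y \<sigma>)"

definition Baire_space :: "'a topology \<Rightarrow> bool" where
  "Baire_space Y \<longleftrightarrow>
     (\<forall>U :: nat \<Rightarrow> 'a set.
        (\<forall>n. openin Y (U n) \<and> Y closure_of U n = topspace Y) \<longrightarrow>
        Y closure_of (\<Inter>n. U n) = topspace Y)"

section \<open>Completeness of spaces of real functions\<close>

definition directed_set :: "'i set \<Rightarrow> ('i \<Rightarrow> 'i \<Rightarrow> bool) \<Rightarrow> bool" where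
  "directed_set I le \<longleftrightarrow>
     I \<noteq> {} \<and> (\<forall>i\<in>I. le i i) \<and>
     (\<forall>i\<in>I. \<forall>j\<in>I. \<forall>k\<in>I. le i j \<longrightarrow> le j k \<longrightarrow> le i k) \<and>
     (\<forall>i\<in>I. \<forall>j\<in>I. \<exists>k\<in>I. le i k \<and> le j k)"

definition net_limit ::
    "'b topology \<Rightarrow> 'i set \<Rightarrow> ('i \<Rightarrow> 'i \<Rightarrow> bool) \<Rightarrow> ('i \<Rightarrow> 'b) \<Rightarrow> 'b \<Rightarrow> bool" where
  "net_limit E I le f l \<longleftrightarrow>
     l \<in> topspace E \<and>
     (\<forall>U. openin E U \<and> l \<in> U \<longrightarrow> (\<exists>k\<in>I. \<forall>i\<in>I. le k i \<longrightarrow> f i \<in> U))"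

text \<open>
  Below, \<open>E\<close> is the topology of a topological vector space consisting of real functions with
  domain \<open>S\<close>. Such functions are represented as elements of \<open>extensional S\<close>, hence the zero
  vector is \<open>\<lambda>x\<in>S. 0\<close> and differences are restricted to \<open>S\<close>.
\<close>

definition Cauchy_net ::
    "'a set \<Rightarrow> ('a \<Rightarrow> real) topology \<Rightarrow> 'i set \<Rightarrow> ('i \<Rightarrow> 'i \<Rightarrow> bool) \<Rightarrow> ('i \<Rightarrow> 'a \<Rightarrow> real) \<Rightarrow> bool" where
  "Cauchy_net S E I le f \<longleftrightarrow>
     (\<forall>i\<in>I. f i \<in> topspace E) \<and>
     (\<forall>U. openin E U \<and> (\<lambda>x\<in>S. 0) \<in> U \<longrightarrow>
        (\<exists>k\<in>I. \<forall>i\<in>I. \<forall>j\<in>I. le k i \<longrightarrow> le k j \<longrightarrow> (\<lambda>x\<in>S. f i x - f j x) \<in> U))"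

text \<open>
  A definition cannot quantify over all index types. The type of the indices used here is large
  enough: by lemma \<open>complete_function_space_net\<close>, completeness yields limits of Cauchy nets
  indexed by arbitrary types.
\<close>

definition complete_function_space :: "'a set \<Rightarrow> ('a \<Rightarrow> real) topology \<Rightarrow> bool" where
  "complete_function_space S E \<longleftrightarrow>
     (\<forall>(I :: (('a \<Rightarrow> real) set \<times> ('a \<Rightarrow> real)) set) le f.
        directed_set I le \<and> Cauchy_net S E I le f \<longrightarrow> (\<exists>l. net_limit E I le f l))"

definition sequentially_complete_function_space ::
    "'a set \<Rightarrow> ('a \<Rightarrow> real) topology \<Rightarrow> bool" where
  "sequentially_complete_function_space S E \<longleftrightarrow>
     (\<forall>f :: nat \<Rightarrow> 'a \<Rightarrow> real.
        Cauchy_net S E UNIV (\<le>) f \<longrightarrow> (\<exists>l. limitin E f l sequentially))"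

lemma complete_function_space_net:
  fixes I :: "'i set"
  assumes E: "complete_function_space S E" and I: "directed_set I le"
    and f: "Cauchy_net S E I le f"
  shows "\<exists>l. net_limit E I le f l"
proof -
  define tl where "tl k = f ` {i\<in>I. le k i}" for k
  define J where "J = {(A, x). (\<exists>k\<in>I. A = tl k) \<and> x \<in> A}"
  define leJ where "leJ p q \<longleftrightarrow> fst q \<subseteq> fst p" for p q :: "('a \<Rightarrow> real) set \<times> ('a \<Rightarrow> real)"
  have refl: "le k k" if "k \<in> I" for k
    using I that unfolding directed_set_def by simp
  have trans: "le i m" if "i \<in> I" "j \<in> I" "m \<in> I" "le i j" "le j m" for i j m
    using I that unfolding directed_set_def by metis
  have self: "(tl k, f k) \<in> J" if "k \<in> I" for k
    using that refl[OF that] by (auto simp: J_def tl_def)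
  have mono: "tl k \<subseteq> tl i" if "i \<in> I" "k \<in> I" "le i k" for i k
    using trans[OF that(1,2) _ that(3)] by (auto simp: tl_def)
  have dir: "\<exists>r\<in>J. leJ p r \<and> leJ q r" if p: "p \<in> J" and q: "q \<in> J" for p q
  proof -
    obtain i j where ij: "i \<in> I" "j \<in> I" "fst p = tl i" "fst q = tl j"
      using p q by (auto simp: J_def)
    then obtain k where k: "k \<in> I" "le i k" "le j k"
      using I unfolding directed_set_def by meson
    then show ?thesis
      using self[OF k(1)] mono[OF ij(1) k(1,2)] mono[OF ij(2) k(1,3)] ij(3,4)
      by (intro bexI[of _ "(tl k, f k)"]) (simp_all add: leJ_def)
  qed
  have "directed_set J leJ"
    unfolding directed_set_def
  proof (intro conjI)
    show "J \<noteq> {}" using self I unfolding directed_set_def by blast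
    show "\<forall>p\<in>J. \<forall>q\<in>J. \<exists>r\<in>J. leJ p r \<and> leJ q r" using dir by blast
  qed (auto simp: leJ_def)
  moreover have "Cauchy_net S E J leJ snd"
    unfolding Cauchy_net_def
  proof (intro conjI allI impI)
    show "\<forall>p\<in>J. snd p \<in> topspace E"
      using f by (auto simp: J_def tl_def Cauchy_net_def)
    fix U assume "openin E U \<and> (\<lambda>x\<in>S. 0) \<in> U"
    then obtain k where k: "k \<in> I"
      "\<And>i j. i \<in> I \<Longrightarrow> j \<in> I \<Longrightarrow> le k i \<Longrightarrow> le k j \<Longrightarrow> (\<lambda>x\<in>S. f i x - f j x) \<in> U"
      using f unfolding Cauchy_net_def by meson
    have "(\<lambda>x\<in>S. snd p x - snd q x) \<in> U"
      if pq: "p \<in> J" "q \<in> J" "leJ (tl k, f k) p" "leJ (tl k, f k) q" for p q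
    proof -
      have "snd p \<in> tl k" "snd q \<in> tl k"
        using pq by (auto simp: J_def leJ_def)
      then show ?thesis using k(2) by (auto simp: tl_def)
    qed
    then show "\<exists>r\<in>J. \<forall>p\<in>J. \<forall>q\<in>J. leJ r p \<longrightarrow> leJ r q \<longrightarrow> (\<lambda>x\<in>S. snd p x - snd q x) \<in> U"
      using self[OF k(1)] by blast
  qed
  ultimately obtain l where l: "net_limit E J leJ snd l"
    using E unfolding complete_function_space_def by blast
  have "\<exists>k\<in>I. \<forall>i\<in>I. le k i \<longrightarrow> f i \<in> U" if U: "openin E U \<and> l \<in> U" for U
  proof -
    obtain r where r: "r \<in> J" "\<And>p. p \<in> J \<Longrightarrow> leJ r p \<Longrightarrow> snd p \<in> U"
      using l U unfolding net_limit_def by meson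
    then obtain k where k: "k \<in> I" "fst r = tl k" by (auto simp: J_def)
    have "f i \<in> U" if "i \<in> I" "le k i" for i
      using r(2)[of "(tl k, f i)"] k that by (auto simp: J_def leJ_def tl_def)
    then show ?thesis using k(1) by blast
  qed
  then show ?thesis using l unfolding net_limit_def by blast
qed

section \<open>The space of functions of the first Baire class\<close>

definition Baire1 :: "'a topology \<Rightarrow> ('a \<Rightarrow> real) set" where
  "Baire1 X = {f \<in> extensional (topspace X).
     \<exists>g :: nat \<Rightarrow> 'a \<Rightarrow> real. (\<forall>n. continuous_map X euclideanreal (g n)) \<and>
       (\<forall>x\<in>topspace X. (\<lambda>n. g n x) \<longlonglongrightarrow> f x)}"

definition Baire1_space :: "'a topology \<Rightarrow> ('a \<Rightarrow> real) topology" where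
  "Baire1_space X = subtopology (product_topology (\<lambda>_. euclideanreal) (topspace X)) (Baire1 X)"

end

theory Submission
  imports Defs
begin

text \<open>
  All parts rest on two facts about a metrizable space \<open>X\<close>. First, by Tietze's theorem a function
  that is constant on each member of a countable closed cover is of the first class, and this class
  is closed under uniform limits; so \<open>f\<close> is of the first class as soon as the sets
  \<open>{x. a \<le> f x < b}\<close> are \<open>F\<^sub>\<sigma>\<close>. Secondly, if \<open>f\<close> is the limit of continuous \<open>g\<^sub>k\<close>, then \<open>X\<close> is the
  union of the closed sets on which all \<open>\<bar>g\<^sub>k\<bar>\<close> are at most \<open>m\<close>; so a set \<open>D\<close> all of whose parts
  \<open>{x \<in> D. \<bar>f x\<bar> \<le> m}\<close> are finite is \<open>G\<^sub>\<delta>\<close>.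

  The second fact turns a Choquet or Baire property of the function space into a \<open>G\<^sub>\<delta>\<close>-set: a
  function that is large on the right finite sets is obtained from two parallel runs of the
  Choquet game, respectively from a countable intersection of dense open sets. Conversely, a
  decreasing sequence of basic open sets prescribes values on a countable set \<open>D\<close>, and the function
  with these values that is zero outside of \<open>D\<close> is of the first class if \<open>D\<close> is \<open>G\<^sub>\<delta>\<close>. For
  \<open>\<kappa>\<close>-sets only a part of \<open>D\<close> is \<open>G\<^sub>\<delta>\<close>, and the construction makes the values on the rest tend
  to zero.
\<close>

section \<open>Functions of the first Baire class\<close>

text \<open>The analytic half of \<open>Baire1\<close>, without the demand that functions be
  \<open>extensional\<close>; closure properties can thus be stated for plain lambda terms.\<close>

definition baire_one :: "'a topology \<Rightarrow> ('a \<Rightarrow> real) \<Rightarrow> bool" where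
  "baire_one X f \<longleftrightarrow>
     (\<exists>g :: nat \<Rightarrow> 'a \<Rightarrow> real. (\<forall>n. continuous_map X euclideanreal (g n)) \<and>
       (\<forall>x\<in>topspace X. (\<lambda>n. g n x) \<longlonglongrightarrow> f x))"

lemma Baire1_iff: "f \<in> Baire1 X \<longleftrightarrow> f \<in> extensional (topspace X) \<and> baire_one X f"
  by (auto simp: Baire1_def baire_one_def)

lemma baire_one_cong:
  "(\<And>x. x \<in> topspace X \<Longrightarrow> f x = g x) \<Longrightarrow> baire_one X f \<longleftrightarrow> baire_one X g"
  by (simp add: baire_one_def)

lemma restrict_in_Baire1: "restrict f (topspace X) \<in> Baire1 X \<longleftrightarrow> baire_one X f"
  using baire_one_cong[of X "restrict f (topspace X)" f] by (simp add: Baire1_iff)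

lemma baire_one_add:
  assumes "baire_one X f" "baire_one X g"
  shows "baire_one X (\<lambda>x. f x + g x)"
proof -
  obtain u v where "\<And>n. continuous_map X euclideanreal (u n)" "\<And>n. continuous_map X euclideanreal (v n)"
    "\<And>x. x \<in> topspace X \<Longrightarrow> (\<lambda>n. u n x) \<longlonglongrightarrow> f x" "\<And>x. x \<in> topspace X \<Longrightarrow> (\<lambda>n. v n x) \<longlonglongrightarrow> g x"
    using assms unfolding baire_one_def by metis
  then show ?thesis
    unfolding baire_one_def
    by (intro exI[of _ "\<lambda>n x. u n x + v n x"]) (auto intro!: continuous_map_add tendsto_add)
qed

lemma baire_one_minus:
  assumes "baire_one X f"
  shows "baire_one X (\<lambda>x. - f x)"
proof -
  obtain u where "\<And>n. continuous_map X euclideanreal (u n)"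
    "\<And>x. x \<in> topspace X \<Longrightarrow> (\<lambda>n. u n x) \<longlonglongrightarrow> f x"
    using assms unfolding baire_one_def by metis
  then show ?thesis
    unfolding baire_one_def
    by (intro exI[of _ "\<lambda>n x. - u n x"]) (auto intro!: continuous_map_minus tendsto_minus)
qed

lemma baire_one_abs:
  assumes "baire_one X f"
  shows "baire_one X (\<lambda>x. \<bar>f x\<bar>)"
proof -
  obtain u where "\<And>n. continuous_map X euclideanreal (u n)"
    "\<And>x. x \<in> topspace X \<Longrightarrow> (\<lambda>n. u n x) \<longlonglongrightarrow> f x"
    using assms unfolding baire_one_def by metis
  then show ?thesis
    unfolding baire_one_def
    by (intro exI[of _ "\<lambda>n x. \<bar>u n x\<bar>"]) (auto intro!: continuous_map_real_abs tendsto_rabs)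
qed

section \<open>Countable covers and uniform limits\<close>

text \<open>The union \<open>K n\<close> of the first members of the cover is closed, and
  \<open>f\<close> is continuous on it by pasting finitely many closed pieces. Tietze extends this
  restriction to \<open>X\<close>. Each point lies in \<open>K n\<close> from some \<open>n\<close>
  on, so there the extensions are eventually equal to \<open>f\<close>.\<close>

lemma baire_one_closed_pieces:
  assumes X: "normal_space X" and "countable \<C>" and C: "\<And>C. C \<in> \<C> \<Longrightarrow> closedin X C"
    and cover: "topspace X \<subseteq> \<Union>\<C>"
    and f: "\<And>C. C \<in> \<C> \<Longrightarrow> continuous_map (subtopology X C) euclideanreal f"
  shows "baire_one X f"
proof (cases "\<C> = {}")
  case True
  then show ?thesis using cover by (auto simp: baire_one_def intro!: exI[of _ "\<lambda>_ _. 0"])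
next
  case False
  define c where "c = from_nat_into \<C>"
  have rng: "range c = \<C>" using False \<open>countable \<C>\<close> by (simp add: c_def range_from_nat_into)
  have c: "c n \<in> \<C>" for n using rng by blast
  define K where "K n = (\<Union>i\<le>n. c i)" for n
  have K: "closedin X (K n)" for n
    unfolding K_def using c C by (intro closedin_Union) auto
  have "continuous_map (subtopology X (K n)) euclideanreal f" for n
  proof (rule pasting_lemma_closed[where I = "{..n}" and T = c and f = "\<lambda>_. f"])
    fix i assume "i \<in> {..n}"
    then have sub: "c i \<subseteq> K n" by (auto simp: K_def)
    show "closedin (subtopology X (K n)) (c i)"
      using sub C[OF c] by (simp add: closedin_closed_subtopology K)
    show "continuous_map (subtopology (subtopology X (K n)) (c i)) euclideanreal f"
      using f[OF c] sub by (simp add: subtopology_subtopology inf.absorb2)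
  qed (auto simp: K_def)
  then have "\<exists>g. continuous_map X euclideanreal g \<and> (\<forall>x\<in>K n. g x = f x)" for n
    using Tietze_extension_realinterval[OF X K is_interval_univ UNIV_not_empty, of n f]
    by (metis subset_UNIV)
  then obtain g where g: "\<And>n. continuous_map X euclideanreal (g n)" "\<And>n x. x \<in> K n \<Longrightarrow> g n x = f x"
    by metis
  have "(\<lambda>n. g n x) \<longlonglongrightarrow> f x" if x: "x \<in> topspace X" for x
  proof -
    obtain C where "C \<in> \<C>" "x \<in> C" using x cover by blast
    then obtain i where "x \<in> c i" using rng by (metis imageE)
    then have "g n x = f x" if "n \<ge> i" for n
      using that by (intro g(2)) (auto simp: K_def)
    then show ?thesis
      by (intro tendsto_eventually) (auto simp: eventually_sequentially)
  qed
  then show ?thesis unfolding baire_one_def using g(1) by blast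
qed

lemma baire_one_fsigma_pieces:
  assumes X: "normal_space X" and \<A>: "countable \<A>" "\<And>A. A \<in> \<A> \<Longrightarrow> fsigma_in X A"
    and cover: "topspace X \<subseteq> \<Union>\<A>"
    and f: "\<And>A. A \<in> \<A> \<Longrightarrow> \<exists>c. \<forall>x\<in>A. f x = c"
  shows "baire_one X f"
proof -
  have "\<exists>\<U>. countable \<U> \<and> \<U> \<subseteq> Collect (closedin X) \<and> \<Union>\<U> = A" if "A \<in> \<A>" for A
    using \<A>(2)[OF that] by (simp add: fsigma_in_def union_of_def)
  then obtain \<U> where \<U>: "\<And>A. A \<in> \<A> \<Longrightarrow> countable (\<U> A)"
    "\<And>A. A \<in> \<A> \<Longrightarrow> \<U> A \<subseteq> Collect (closedin X)" "\<And>A. A \<in> \<A> \<Longrightarrow> \<Union>(\<U> A) = A"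
    by metis
  show ?thesis
  proof (rule baire_one_closed_pieces[OF X])
    show "countable (\<Union>(\<U> ` \<A>))" using \<A>(1) \<U>(1) by blast
    show "topspace X \<subseteq> \<Union>(\<Union>(\<U> ` \<A>))" using cover \<U>(3) by blast
    fix C assume "C \<in> \<Union>(\<U> ` \<A>)"
    then obtain A where A: "A \<in> \<A>" "C \<in> \<U> A" by blast
    then show "closedin X C" using \<U>(2) by blast
    obtain c where "\<And>x. x \<in> C \<Longrightarrow> f x = c" using f[OF A(1)] A \<U>(3) by blast
    then show "continuous_map (subtopology X C) euclideanreal f"
      using continuous_map_eq[of "subtopology X C" euclideanreal "\<lambda>_. c" f] by simp
  qed
qed

text \<open>Write \<open>f\<close> as \<open>h 0\<close> plus the telescoping series of the
  differences \<open>h (Suc k) - h k\<close>. Truncating the continuous approximants of each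
  difference at its bound \<open>M k\<close> dominates everything by a summable series, and
  Tannery's theorem interchanges the limit with the sum.\<close>

lemma baire_one_uniform_limit:
  assumes h: "\<And>k. baire_one X (h k)"
    and fh: "\<And>k x. x \<in> topspace X \<Longrightarrow> \<bar>f x - h k x\<bar> \<le> (1/2) ^ k"
  shows "baire_one X f"
proof -
  have "\<exists>u :: nat \<Rightarrow> 'a \<Rightarrow> real. (\<forall>n. continuous_map X euclideanreal (u n)) \<and>
      (\<forall>x\<in>topspace X. (\<lambda>n. u n x) \<longlonglongrightarrow> h (Suc k) x - h k x)" for k
    using baire_one_add[OF h baire_one_minus[OF h], of "Suc k" k] by (simp add: baire_one_def)
  then obtain u where u: "\<And>k n. continuous_map X euclideanreal (u k n)"
    "\<And>k x. x \<in> topspace X \<Longrightarrow> (\<lambda>n. u k n x) \<longlonglongrightarrow> h (Suc k) x - h k x"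
    by metis
  obtain v where v: "\<And>n. continuous_map X euclideanreal (v n)"
    "\<And>x. x \<in> topspace X \<Longrightarrow> (\<lambda>n. v n x) \<longlonglongrightarrow> h 0 x"
    using h[of 0] unfolding baire_one_def by metis
  \<comment> \<open>Both \<open>h k\<close> and \<open>h (Suc k)\<close> are within
    \<open>(1/2) ^ k\<close> of \<open>f\<close>, so they differ by at most
    \<open>M k\<close>.\<close>
  define M :: "nat \<Rightarrow> real" where "M k = 2 * (1/2) ^ k" for k
  define w where "w k n x = max (- M k) (min (M k) (u k n x))" for k n x
  define G where "G n x = v n x + (\<Sum>k<n. w k n x)" for n x
  have M0: "M k \<ge> 0" for k by (simp add: M_def)
  have "continuous_map X euclideanreal (G n)" for n
    unfolding G_def w_def
    by (intro continuous_map_add continuous_map_sum continuous_map_real_max continuous_map_real_min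
        u v continuous_map_const[THEN iffD2]) auto
  moreover have "(\<lambda>n. G n x) \<longlonglongrightarrow> f x" if x: "x \<in> topspace X" for x
  proof -
    define b where "b k = h (Suc k) x - h k x" for k
    \<comment> \<open>The zeros for \<open>k \<ge> n\<close> turn the finite sum in
      \<open>G n\<close> into an infinite series, the form that Tannery's theorem treats.\<close>
    define a where "a k n = (if k < n then w k n x else 0)" for k n
    have bM: "\<bar>b k\<bar> \<le> M k" for k
      using fh[OF x, of k] fh[OF x, of "Suc k"] zero_le_power[of "1/2 :: real" k]
      unfolding b_def M_def power_Suc by linarith
    have "(\<lambda>n. a k n) \<longlonglongrightarrow> b k" for k
    proof -
      have "(\<lambda>n. w k n x) \<longlonglongrightarrow> max (- M k) (min (M k) (b k))"
        unfolding w_def b_def by (intro tendsto_max tendsto_min tendsto_const u(2) x)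
      also have "max (- M k) (min (M k) (b k)) = b k" using bM[of k] by (auto simp: abs_le_iff)
      finally show ?thesis
        by (rule Lim_transform_eventually)
          (auto simp: a_def eventually_sequentially intro!: exI[of _ "Suc k"])
    qed
    moreover have "norm (a k n) \<le> M k" for k n
      using M0[of k] by (auto simp: a_def w_def)
    moreover have "summable M" unfolding M_def by (intro summable_mult) simp
    ultimately have "(\<lambda>n. suminf (\<lambda>k. a k n)) \<longlonglongrightarrow> suminf b"
      by (intro tannerys_theorem[where M = M, THEN conjunct2, THEN conjunct2])
        (auto intro!: always_eventually)
    moreover have "suminf (\<lambda>k. a k n) = (\<Sum>k<n. w k n x)" for n
      by (subst suminf_finite[of "{..<n}"]) (auto simp: a_def)
    moreover have "suminf b = f x - h 0 x"
    proof (rule sums_unique[symmetric])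
      have "(\<lambda>k. f x - h k x) \<longlonglongrightarrow> 0"
        by (rule Lim_null_comparison[of _ "\<lambda>k. (1/2) ^ k"])
          (use fh[OF x] in \<open>auto intro!: LIMSEQ_realpow_zero\<close>)
      then have "(\<lambda>k. h k x) \<longlonglongrightarrow> f x"
        using tendsto_diff[OF tendsto_const[of "f x"]] by fastforce
      then show "b sums (f x - h 0 x)"
        unfolding b_def by (rule telescope_sums)
    qed
    ultimately show ?thesis
      unfolding G_def using tendsto_add[OF v(2)[OF x]] by fastforce
  qed
  ultimately show ?thesis unfolding baire_one_def by blast
qed

text \<open>Rounding \<open>f\<close> down to multiples of \<open>1 / 2 ^ k\<close> gives functions
  that are constant on countably many half-open level sets and converge uniformly to
  \<open>f\<close>.\<close>

lemma baire_one_level_sets: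
  assumes X: "normal_space X"
    and f: "\<And>a b. fsigma_in X {x \<in> topspace X. a \<le> f x \<and> f x < b}"
  shows "baire_one X f"
proof -
  define h where "h k x = real_of_int \<lfloor>2 ^ k * f x\<rfloor> / 2 ^ k" for k :: nat and x
  define A where "A k m = {x \<in> topspace X. m / 2 ^ k \<le> f x \<and> f x < (m + 1) / 2 ^ k}"
    for k :: nat and m :: int
  have A_iff: "x \<in> A k m \<longleftrightarrow> x \<in> topspace X \<and> \<lfloor>2 ^ k * f x\<rfloor> = m" for x k m
    by (auto simp: A_def floor_eq_iff field_simps)
  have "baire_one X (h k)" for k
    by (rule baire_one_fsigma_pieces[OF X, of "range (A k)"])
      (auto simp: A_iff h_def, auto simp: A_def intro: f)
  moreover have "\<bar>f x - h k x\<bar> \<le> (1/2) ^ k" for k x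
  proof -
    have "f x - h k x = frac (2 ^ k * f x) / 2 ^ k"
      by (simp add: h_def frac_def field_simps)
    then show ?thesis
      using frac_lt_1[of "2 ^ k * f x"] frac_ge_0[of "2 ^ k * f x"]
      by (simp add: power_divide divide_right_mono)
  qed
  ultimately show ?thesis by (rule baire_one_uniform_limit)
qed

section \<open>Level sets of functions of the first class\<close>

text \<open>The margin \<open>1 / Suc m\<close> lets the strict inequality survive the passage to
  the limit. The \<open>g n\<close> are arbitrary, so the formula serves for continuous functions
  (closed inner sets) and for functions of the first class (inner sets that are
  \<open>G\<^sub>\<delta>\<close>).\<close>

lemma limit_sublevel_eq:
  fixes g :: "nat \<Rightarrow> 'a \<Rightarrow> real"
  assumes "\<And>x. x \<in> S \<Longrightarrow> (\<lambda>n. g n x) \<longlonglongrightarrow> f x"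
  shows "{x\<in>S. f x < a} = (\<Union>m::nat. \<Union>k. \<Inter>n\<in>{k..}. {x\<in>S. g n x \<le> a - 1 / Suc m})"
proof (intro set_eqI iffI)
  fix x assume "x \<in> {x\<in>S. f x < a}"
  then have x: "x \<in> S" "f x < a" by auto
  obtain m :: nat where m: "1 / Suc m < a - f x"
    using x(2) nat_approx_posE[of "a - f x"] by auto
  have "eventually (\<lambda>n. g n x < a - 1 / Suc m) sequentially"
    by (rule order_tendstoD(2)[OF assms[OF x(1)]]) (use m in auto)
  then obtain k where "\<And>n. n \<ge> k \<Longrightarrow> g n x < a - 1 / Suc m"
    by (auto simp: eventually_sequentially)
  then have "x \<in> (\<Inter>n\<in>{k..}. {x\<in>S. g n x \<le> a - 1 / Suc m})" using x(1) by (auto intro: less_imp_le)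
  then show "x \<in> (\<Union>m::nat. \<Union>k. \<Inter>n\<in>{k..}. {x\<in>S. g n x \<le> a - 1 / Suc m})" by blast
next
  fix x assume "x \<in> (\<Union>m::nat. \<Union>k. \<Inter>n\<in>{k..}. {x\<in>S. g n x \<le> a - 1 / Suc m})"
  then obtain m k :: nat where mk: "x \<in> (\<Inter>n\<in>{k..}. {x\<in>S. g n x \<le> a - 1 / Suc m})" by blast
  then have x: "x \<in> S" by auto
  have "f x \<le> a - 1 / Suc m"
    by (rule LIMSEQ_le_const2[OF assms[OF x]]) (use mk in auto)
  moreover have "0 < 1 / real (Suc m)" by simp
  ultimately have "f x < a" by linarith
  then show "x \<in> {x\<in>S. f x < a}" using x by auto
qed

lemma baire_one_fsigma_less:
  assumes "baire_one X f"
  shows "fsigma_in X {x \<in> topspace X. f x < a}"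
proof -
  obtain g where g: "\<And>n. continuous_map X euclideanreal (g n)"
    "\<And>x. x \<in> topspace X \<Longrightarrow> (\<lambda>n. g n x) \<longlonglongrightarrow> f x"
    using assms unfolding baire_one_def by metis
  have "closedin X {x \<in> topspace X. g n x \<le> c}" for n c
    using closedin_continuous_map_preimage[OF g(1), of "{..c}" n] by simp
  then have "closedin X (\<Inter>n\<in>{k..}. {x \<in> topspace X. g n x \<le> c})" for k c
    by (intro closedin_Inter) auto
  then have "fsigma_in X (\<Union>k. \<Inter>n\<in>{k..}. {x \<in> topspace X. g n x \<le> c})" for c
    by (blast intro: fsigma_in_Union closed_imp_fsigma_in)
  then have "fsigma_in X (\<Union>m::nat. \<Union>k. \<Inter>n\<in>{k..}. {x \<in> topspace X. g n x \<le> a - 1 / Suc m})"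
    by (intro fsigma_in_Union) blast+
  then show ?thesis
    using limit_sublevel_eq[of "topspace X" g f a] g(2) by simp
qed

lemma baire_one_fsigma_greater:
  assumes "baire_one X f"
  shows "fsigma_in X {x \<in> topspace X. a < f x}"
  using baire_one_fsigma_less[OF baire_one_minus[OF assms], of "- a"] by simp

lemma baire_one_gdelta_le:
  assumes "baire_one X f"
  shows "gdelta_in X {x \<in> topspace X. f x \<le> a}"
proof -
  have "topspace X - {x \<in> topspace X. f x \<le> a} = {x \<in> topspace X. a < f x}" by auto
  then show ?thesis
    using baire_one_fsigma_greater[OF assms] by (simp add: gdelta_in_fsigma_in)
qed

lemma baire_one_gdelta_ge:
  assumes "baire_one X f"
  shows "gdelta_in X {x \<in> topspace X. a \<le> f x}"
  using baire_one_gdelta_le[OF baire_one_minus[OF assms], of "- a"] by simp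

lemma countable_imp_fsigma_in:
  assumes "t1_space X" "countable D" "D \<subseteq> topspace X"
  shows "fsigma_in X D"
proof -
  have "fsigma_in X (\<Union>x\<in>D. {x})"
    using assms by (intro fsigma_in_Union) (auto intro: closed_imp_fsigma_in closedin_t1_singleton)
  then show ?thesis by simp
qed

text \<open>Convergent sequences are bounded, so the closed sets \<open>K m\<close> cover
  \<open>X\<close>. On \<open>K m\<close> also the limit is bounded by \<open>m\<close>, hence
  \<open>K m\<close> meets \<open>D\<close> in a finite set and \<open>K m - D\<close> is
  \<open>F\<^sub>\<sigma>\<close>. These differences make up the complement of
  \<open>D\<close>.\<close>

lemma gdelta_in_of_finite_bounded_parts:
  assumes X: "metrizable_space X" and f: "baire_one X f" and D: "D \<subseteq> topspace X"
    and fin: "\<And>m :: nat. finite {x\<in>D. \<bar>f x\<bar> \<le> m}"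
  shows "gdelta_in X D"
proof -
  obtain g where g: "\<And>n. continuous_map X euclideanreal (g n)"
    "\<And>x. x \<in> topspace X \<Longrightarrow> (\<lambda>n. g n x) \<longlonglongrightarrow> f x"
    using f unfolding baire_one_def by metis
  define K where "K m = (\<Inter>n. {x \<in> topspace X. g n x \<in> {- real m..real m}})" for m :: nat
  have K: "closedin X (K m)" for m
    unfolding K_def
    by (intro closedin_Inter) (auto intro!: closedin_continuous_map_preimage[OF g(1)] simp del: atLeastAtMost_iff)
  have bd: "\<bar>f x\<bar> \<le> m" if "x \<in> K m" for x m
  proof -
    have "(\<lambda>n. \<bar>g n x\<bar>) \<longlonglongrightarrow> \<bar>f x\<bar>"
      using that by (intro tendsto_rabs g(2)) (auto simp: K_def)
    then show ?thesis
      by (rule LIMSEQ_le_const2) (use that in \<open>auto simp: K_def abs_le_iff minus_le_iff\<close>)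
  qed
  have fsig: "fsigma_in X (K m - D)" for m
  proof -
    have "{x\<in>D. x \<in> K m} \<subseteq> {x\<in>D. \<bar>f x\<bar> \<le> m}" using bd by auto
    then have "finite {x\<in>D. x \<in> K m}" using fin finite_subset by blast
    then have "closedin X {x\<in>D. x \<in> K m}"
      using D metrizable_imp_t1_space[OF X] by (auto simp: t1_space_closedin_finite)
    then have "fsigma_in X (K m - {x\<in>D. x \<in> K m})"
      using X K by (intro fsigma_in_diff closed_imp_fsigma_in closed_imp_gdelta_in)
    moreover have "K m - {x\<in>D. x \<in> K m} = K m - D" by auto
    ultimately show ?thesis by simp
  qed
  have "\<exists>m. x \<in> K m" if x: "x \<in> topspace X" for x
  proof -
    obtain B where B: "\<And>n. \<bar>g n x\<bar> \<le> B"
      using convergent_imp_Bseq[of "\<lambda>n. g n x"] g(2)[OF x] by (auto simp: Bseq_def convergent_def)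
    obtain m :: nat where "B \<le> m" using real_arch_simple by blast
    then have "\<bar>g n x\<bar> \<le> m" for n using B[of n] by linarith
    then show ?thesis using x by (auto simp: K_def abs_le_iff minus_le_iff)
  qed
  then have "topspace X - D = (\<Union>m. K m - D)" by (auto simp: K_def)
  moreover have "fsigma_in X (\<Union>m. K m - D)" using fsig by (intro fsigma_in_Union) auto
  ultimately show ?thesis using D by (simp add: gdelta_in_fsigma_in)
qed

lemma topspace_Baire1_space [simp]: "topspace (Baire1_space X) = Baire1 X"
  by (auto simp: Baire1_space_def Baire1_def PiE_def)

text \<open>The complement of \<open>D\<close> and the singletons in \<open>D\<close> form a
  countable cover by \<open>F\<^sub>\<sigma>\<close>-sets on each of which \<open>f\<close> is
  constant.\<close>

lemma baire_one_countable_support: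
  assumes X: "metrizable_space X" and D: "gdelta_in X D" "countable D"
    and f: "\<And>x. x \<in> topspace X \<Longrightarrow> x \<notin> D \<Longrightarrow> f x = 0"
  shows "baire_one X f"
proof (rule baire_one_fsigma_pieces[OF metrizable_imp_normal_space[OF X]])
  show "countable (insert (topspace X - D) ((\<lambda>x. {x}) ` D))" using D(2) by simp
  show "topspace X \<subseteq> \<Union>(insert (topspace X - D) ((\<lambda>x. {x}) ` D))" by auto
  fix A assume A: "A \<in> insert (topspace X - D) ((\<lambda>x. {x}) ` D)"
  show "\<exists>c. \<forall>x\<in>A. f x = c" using A f by auto
  have "closedin X {x}" if "x \<in> D" for x
    using that gdelta_in_subset[OF D(1)]
    by (intro closedin_t1_singleton metrizable_imp_t1_space[OF X]) auto
  moreover have "fsigma_in X (topspace X - D)"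
    using D(1) by (simp add: fsigma_in_diff closed_imp_fsigma_in)
  ultimately show "fsigma_in X A" using A by (auto intro: closed_imp_fsigma_in)
qed

lemma baire_one_finite_support:
  assumes X: "metrizable_space X" and F: "finite F" "F \<subseteq> topspace X"
    and f: "\<And>x. x \<in> topspace X \<Longrightarrow> x \<notin> F \<Longrightarrow> f x = 0"
  shows "baire_one X f"
proof (rule baire_one_countable_support[OF X])
  have "closedin X F"
    using F metrizable_imp_t1_space[OF X] by (auto simp: t1_space_closedin_finite)
  then show "gdelta_in X F" by (rule closed_imp_gdelta_in[OF X])
qed (use F f in \<open>auto simp: countable_finite\<close>)

lemma Baire1_zero: "(\<lambda>x\<in>topspace X. 0) \<in> Baire1 X"
  unfolding restrict_in_Baire1 baire_one_def by (intro exI[of _ "\<lambda>_ _. 0"]) auto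

text \<open>This is the density of \<open>Baire1 X\<close> in the full power of the real line; it
  supplies the points of all basic open sets below.\<close>

lemma Baire1_interpolate:
  assumes X: "metrizable_space X" and F: "finite F" "F \<subseteq> topspace X"
  obtains f where "f \<in> Baire1 X" "\<And>x. x \<in> F \<Longrightarrow> f x = p x"
proof
  show "restrict (\<lambda>x. if x \<in> F then p x else 0) (topspace X) \<in> Baire1 X"
    unfolding restrict_in_Baire1 by (rule baire_one_finite_support[OF X F]) simp
qed (use F in auto)

section \<open>The topology of pointwise convergence\<close>

lemma continuous_map_Baire1_eval:
  assumes "x \<in> topspace X"
  shows "continuous_map (Baire1_space X) euclideanreal (\<lambda>f. f x)"
  unfolding Baire1_space_def
  by (intro continuous_map_from_subtopology continuous_map_product_projection assms)

lemma openin_Baire1_box: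
  assumes F: "finite F" "F \<subseteq> topspace X" and W: "\<And>x. x \<in> F \<Longrightarrow> open (W x)"
  shows "openin (Baire1_space X) {f \<in> Baire1 X. \<forall>x\<in>F. f x \<in> W x}"
proof -
  have "openin (Baire1_space X) {f \<in> Baire1 X. f x \<in> W x}" if "x \<in> F" for x
    using openin_continuous_map_preimage[OF continuous_map_Baire1_eval, of x X "W x"] that F(2) W
    by auto
  then have "openin (Baire1_space X) (Baire1 X \<inter> (\<Inter>x\<in>F. {f \<in> Baire1 X. f x \<in> W x}))"
    using F(1) openin_topspace[of "Baire1_space X"]
    by (cases "F = {}") (auto intro!: openin_Int openin_Inter)
  moreover have "Baire1 X \<inter> (\<Inter>x\<in>F. {f \<in> Baire1 X. f x \<in> W x}) = {f \<in> Baire1 X. \<forall>x\<in>F. f x \<in> W x}"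
    by auto
  ultimately show ?thesis by simp
qed

text \<open>The basic open sets, with one radius for all coordinates in \<open>F\<close>. The centre
  \<open>p\<close> may be any function, of the first class or not.\<close>

definition nb :: "'a topology \<Rightarrow> ('a \<Rightarrow> real) \<Rightarrow> 'a set \<Rightarrow> real \<Rightarrow> ('a \<Rightarrow> real) set" where
  "nb X p F e = {f \<in> Baire1 X. \<forall>x\<in>F. \<bar>f x - p x\<bar> < e}"

lemma openin_nb:
  assumes "finite F" "F \<subseteq> topspace X"
  shows "openin (Baire1_space X) (nb X p F e)"
proof -
  have "nb X p F e = {f \<in> Baire1 X. \<forall>x\<in>F. f x \<in> ball (p x) e}"
    by (auto simp: nb_def dist_real_def abs_minus_commute)
  then show ?thesis using openin_Baire1_box[OF assms, of "\<lambda>x. ball (p x) e"] by simp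
qed

lemma openin_Baire1_nb:
  assumes U: "openin (Baire1_space X) U" and f: "f \<in> U"
  obtains F e where "finite F" "F \<subseteq> topspace X" "e > 0" "nb X f F e \<subseteq> U"
proof -
  obtain T where T: "openin (product_topology (\<lambda>_. euclideanreal) (topspace X)) T"
    "U = T \<inter> Baire1 X"
    using U by (auto simp: Baire1_space_def openin_subtopology)
  then obtain W where W: "finite {i \<in> topspace X. W i \<noteq> UNIV}" "\<And>i. i \<in> topspace X \<Longrightarrow> open (W i)"
    "f \<in> Pi\<^sub>E (topspace X) W" "Pi\<^sub>E (topspace X) W \<subseteq> T"
    using f unfolding openin_product_topology_alt by auto
  define F where "F = {i \<in> topspace X. W i \<noteq> UNIV}"
  have "\<exists>d>0. ball (f i) d \<subseteq> W i" if "i \<in> F" for i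
    using W(2)[of i] W(3) that open_contains_ball[of "W i"] by (auto simp: F_def)
  then obtain d where d: "\<And>i. i \<in> F \<Longrightarrow> d i > 0" "\<And>i. i \<in> F \<Longrightarrow> ball (f i) (d i) \<subseteq> W i"
    by metis
  \<comment> \<open>The \<open>1\<close> keeps the minimum meaningful for empty
    \<open>F\<close>.\<close>
  define e where "e = Min (insert 1 (d ` F))"
  have fin: "finite F" using W(1) by (simp add: F_def)
  have e: "e > 0" "\<And>i. i \<in> F \<Longrightarrow> e \<le> d i"
    using d(1) fin by (auto simp: e_def)
  have "h \<in> U" if h: "h \<in> nb X f F e" for h
  proof -
    have "h i \<in> W i" if i: "i \<in> topspace X" for i
    proof (cases "i \<in> F")
      case True
      then have "h i \<in> ball (f i) (d i)"
        using h e(2)[OF True] by (fastforce simp: nb_def dist_real_def abs_minus_commute)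
      then show ?thesis using d(2)[OF True] by blast
    next
      case False
      then show ?thesis using i by (simp add: F_def)
    qed
    then have "h \<in> Pi\<^sub>E (topspace X) W"
      using h by (auto simp: nb_def Baire1_iff PiE_def)
    then show ?thesis using W(4) T(2) h by (auto simp: nb_def)
  qed
  then show thesis using that[of F e] fin e(1) by (auto simp: F_def)
qed

lemma nb_nonempty:
  assumes "metrizable_space X" "finite F" "F \<subseteq> topspace X" "e > 0"
  shows "nb X p F e \<noteq> {}"
proof -
  obtain f where "f \<in> Baire1 X" "\<And>x. x \<in> F \<Longrightarrow> f x = p x"
    using Baire1_interpolate[OF assms(1-3)] by metis
  then have "f \<in> nb X p F e" using assms(4) by (simp add: nb_def)
  then show ?thesis by blast
qed

lemma nb_refine:
  assumes F: "finite F" "F \<subseteq> topspace X" and U: "openin (Baire1_space X) U"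
    and ne: "U \<inter> nb X p F e \<noteq> {}"
  obtains p' F' e' where "finite F'" "F \<subseteq> F'" "F' \<subseteq> topspace X" "e' > 0"
    "\<And>x. x \<in> F \<Longrightarrow> \<bar>p' x - p x\<bar> + e' < e" "nb X p' F' e' \<subseteq> U"
proof -
  obtain f where f: "f \<in> U" "f \<in> nb X p F e" using ne by blast
  obtain G d where G: "finite G" "G \<subseteq> topspace X" "d > 0" "nb X f G d \<subseteq> U"
    using openin_Baire1_nb[OF U f(1)] .
  \<comment> \<open>Half of the room left at each point of \<open>F\<close> gives the strict
    inequality; \<open>d\<close> keeps the new set inside \<open>U\<close>.\<close>
  define e' where "e' = Min (insert d ((\<lambda>x. (e - \<bar>f x - p x\<bar>) / 2) ` F))"
  have e': "e' > 0" "e' \<le> d"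
    using F(1) G(3) f(2) by (auto simp: e'_def nb_def)
  have e'F: "e' \<le> (e - \<bar>f x - p x\<bar>) / 2" if "x \<in> F" for x
    unfolding e'_def using F(1) that by (intro Min_le) auto
  show thesis
  proof (rule that[of "F \<union> G" e' f])
    show "\<bar>f x - p x\<bar> + e' < e" if "x \<in> F" for x
      using e'F[OF that] e'(1) by (simp add: field_simps)
    have "nb X f (F \<union> G) e' \<subseteq> nb X f G d" using e'(2) by (auto simp: nb_def intro: less_le_trans)
    then show "nb X f (F \<union> G) e' \<subseteq> U" using G(4) by blast
  qed (use F G e' in auto)
qed

section \<open>Limits of nested basic open sets\<close>

text \<open>Compactness gives a common point of the closed intervals. By the strict inequality each
  closed interval lies in the preceding open one, so the point is interior to all of them.\<close>

lemma nested_intervals: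
  fixes c e :: "nat \<Rightarrow> real"
  assumes "\<And>n. e n > 0" and step: "\<And>n. \<bar>c (Suc n) - c n\<bar> + e (Suc n) < e n"
  shows "\<exists>y. \<forall>n. \<bar>y - c n\<bar> < e n"
proof -
  have "{c (Suc n) - e (Suc n)..c (Suc n) + e (Suc n)} \<subseteq> {c n - e n..c n + e n}" for n
    using step[of n] by auto
  then have "decseq (\<lambda>n. {c n - e n..c n + e n})"
    by (intro decseq_SucI) blast
  moreover have "{c n - e n..c n + e n} \<noteq> {}" for n
    using assms(1)[of n] by simp
  ultimately have "\<Inter>(range (\<lambda>n. {c n - e n..c n + e n})) \<noteq> {}"
    by (intro compact_nest) (auto simp: decseq_def)
  then obtain y where y: "\<And>n. y \<in> {c n - e n..c n + e n}" by blast
  have "\<bar>y - c n\<bar> < e n" for n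
    using y[of "Suc n"] step[of n] by (auto simp: abs_if split: if_splits)
  then show ?thesis by blast
qed

text \<open>The centres at a point \<open>x\<close> are controlled only from the first index
  \<open>k\<close> with \<open>x \<in> F k\<close>, so the nested intervals at \<open>x\<close>
  start there.\<close>

lemma nested_nb_limit:
  assumes e: "\<And>n. e n > 0" and mono: "\<And>n. F n \<subseteq> F (Suc n)"
    and step: "\<And>n x. x \<in> F n \<Longrightarrow> \<bar>p (Suc n) x - p n x\<bar> + e (Suc n) < e n"
  obtains g :: "'a \<Rightarrow> real" where "\<And>n x. x \<in> F n \<Longrightarrow> \<bar>g x - p n x\<bar> < e n"
proof -
  have inc: "F m \<subseteq> F n" if "m \<le> n" for m n
    using mono that by (rule lift_Suc_mono_le)
  have "\<exists>y. \<forall>n. x \<in> F n \<longrightarrow> \<bar>y - p n x\<bar> < e n" for x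
  proof (cases "\<exists>n. x \<in> F n")
    case True
    define k where "k = (LEAST n. x \<in> F n)"
    have k: "x \<in> F (k + n)" for n
      using LeastI_ex[OF True] inc[of k "k + n"] by (auto simp: k_def)
    obtain y where y: "\<And>n. \<bar>y - p (k + n) x\<bar> < e (k + n)"
      using nested_intervals[of "\<lambda>n. e (k + n)" "\<lambda>n. p (k + n) x"] e step[OF k] by auto
    have "\<bar>y - p n x\<bar> < e n" if "x \<in> F n" for n
      using y[of "n - k"] Least_le[of "\<lambda>n. x \<in> F n", OF that] by (simp add: k_def)
    then show ?thesis by blast
  qed auto
  then obtain g where "\<And>x n. x \<in> F n \<Longrightarrow> \<bar>g x - p n x\<bar> < e n" by metis
  then show thesis using that by blast
qed

section \<open>Completeness\<close>

text \<open>A neighbourhood in the pointwise topology constrains finitely many points; this merges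
  the indices found at each of them into one.\<close>

lemma directed_finite_bound:
  assumes I: "directed_set I le" and "finite F"
    and up: "\<And>x k k'. k \<in> I \<Longrightarrow> k' \<in> I \<Longrightarrow> le k k' \<Longrightarrow> P x k \<Longrightarrow> P x k'"
    and ex: "\<And>x. x \<in> F \<Longrightarrow> \<exists>k\<in>I. P x k"
  shows "\<exists>k\<in>I. \<forall>x\<in>F. P x k"
  using \<open>finite F\<close> ex
proof (induction F rule: finite_induct)
  case empty
  then show ?case using I unfolding directed_set_def by blast
next
  case (insert x F)
  then obtain k where k: "k \<in> I" "\<forall>y\<in>F. P y k" by auto
  obtain j where j: "j \<in> I" "P x j" using insert.prems by auto
  obtain i where "i \<in> I" "le k i" "le j i"
    using I k(1) j(1) unfolding directed_set_def by meson
  then show ?case using k j up by (intro bexI[of _ i]) auto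
qed

text \<open>One direction tests the net on neighbourhoods of zero that constrain a single point; the
  other merges the indices belonging to finitely many points.\<close>

lemma Cauchy_net_Baire1_iff:
  assumes I: "directed_set I le"
  shows "Cauchy_net (topspace X) (Baire1_space X) I le f \<longleftrightarrow>
    (\<forall>i\<in>I. f i \<in> Baire1 X) \<and>
    (\<forall>x\<in>topspace X. \<forall>e>0. \<exists>k\<in>I. \<forall>i\<in>I. \<forall>j\<in>I. le k i \<longrightarrow> le k j \<longrightarrow> \<bar>f i x - f j x\<bar> < e)"
    (is "?L \<longleftrightarrow> ?B \<and> ?R")
proof (intro iffI conjI)
  let ?d = "\<lambda>i j. \<lambda>x\<in>topspace X. f i x - f j x"
  assume L: ?L
  then show ?B by (simp add: Cauchy_net_def)
  show ?R
  proof (intro ballI allI impI)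
    fix x and e :: real assume x: "x \<in> topspace X" and e: "e > 0"
    have "openin (Baire1_space X) (nb X (\<lambda>_. 0) {x} e)" using x by (intro openin_nb) auto
    moreover have "(\<lambda>x\<in>topspace X. 0) \<in> nb X (\<lambda>_. 0) {x} e" using x e Baire1_zero by (auto simp: nb_def)
    ultimately obtain k where "k \<in> I"
      "\<And>i j. i \<in> I \<Longrightarrow> j \<in> I \<Longrightarrow> le k i \<Longrightarrow> le k j \<Longrightarrow> ?d i j \<in> nb X (\<lambda>_. 0) {x} e"
      using L unfolding Cauchy_net_def by meson
    then show "\<exists>k\<in>I. \<forall>i\<in>I. \<forall>j\<in>I. le k i \<longrightarrow> le k j \<longrightarrow> \<bar>f i x - f j x\<bar> < e"
      using x by (intro bexI[of _ k]) (auto simp: nb_def)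
  qed
next
  let ?d = "\<lambda>i j. \<lambda>x\<in>topspace X. f i x - f j x"
  assume BR: "?B \<and> ?R"
  have tr: "le i m" if "i \<in> I" "j \<in> I" "m \<in> I" "le i j" "le j m" for i j m
    using I that unfolding directed_set_def by metis
  have d: "?d i j \<in> Baire1 X" if "i \<in> I" "j \<in> I" for i j
    unfolding restrict_in_Baire1 using baire_one_add[OF _ baire_one_minus, of X "f i" "f j"] BR that
    by (auto simp: Baire1_iff)
  show ?L
    unfolding Cauchy_net_def
  proof (intro conjI allI impI)
    show "\<forall>i\<in>I. f i \<in> topspace (Baire1_space X)" using BR by simp
    fix U assume U: "openin (Baire1_space X) U \<and> (\<lambda>x\<in>topspace X. 0) \<in> U"
    obtain F e where F: "finite F" "F \<subseteq> topspace X" "e > 0" "nb X (\<lambda>x\<in>topspace X. 0) F e \<subseteq> U"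
      using openin_Baire1_nb U by metis
    have "\<exists>k\<in>I. \<forall>x\<in>F. \<forall>i\<in>I. \<forall>j\<in>I. le k i \<longrightarrow> le k j \<longrightarrow> \<bar>f i x - f j x\<bar> < e"
      by (rule directed_finite_bound[OF I F(1)]) (use tr in blast, use F BR in blast)
    then obtain k where "k \<in> I"
      and k: "\<And>x i j. x \<in> F \<Longrightarrow> i \<in> I \<Longrightarrow> j \<in> I \<Longrightarrow> le k i \<Longrightarrow> le k j \<Longrightarrow> \<bar>f i x - f j x\<bar> < e"
      by metis
    have "?d i j \<in> nb X (\<lambda>x\<in>topspace X. 0) F e" if "i \<in> I" "j \<in> I" "le k i" "le k j" for i j
      using k[OF _ that] d[OF that(1,2)] F(2) by (auto simp: nb_def subset_iff)
    then show "\<exists>k\<in>I. \<forall>i\<in>I. \<forall>j\<in>I. le k i \<longrightarrow> le k j \<longrightarrow> ?d i j \<in> U"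
      using \<open>k \<in> I\<close> F(4) by blast
  qed
qed

lemma net_limit_Baire1_iff:
  assumes I: "directed_set I le" and f: "\<And>i. i \<in> I \<Longrightarrow> f i \<in> Baire1 X"
  shows "net_limit (Baire1_space X) I le f l \<longleftrightarrow> l \<in> Baire1 X \<and>
    (\<forall>x\<in>topspace X. \<forall>e>0. \<exists>k\<in>I. \<forall>i\<in>I. le k i \<longrightarrow> \<bar>f i x - l x\<bar> < e)" (is "?L \<longleftrightarrow> ?B \<and> ?R")
proof (intro iffI conjI)
  assume L: ?L
  then show l: ?B by (simp add: net_limit_def)
  show ?R
  proof (intro ballI allI impI)
    fix x and e :: real assume x: "x \<in> topspace X" and e: "e > 0"
    have "openin (Baire1_space X) (nb X l {x} e)" using x by (intro openin_nb) auto
    moreover have "l \<in> nb X l {x} e" using e l by (auto simp: nb_def)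
    ultimately show "\<exists>k\<in>I. \<forall>i\<in>I. le k i \<longrightarrow> \<bar>f i x - l x\<bar> < e"
      using L unfolding net_limit_def nb_def by fastforce
  qed
next
  assume BR: "?B \<and> ?R"
  have tr: "le i m" if "i \<in> I" "j \<in> I" "m \<in> I" "le i j" "le j m" for i j m
    using I that unfolding directed_set_def by metis
  show ?L
    unfolding net_limit_def
  proof (intro conjI allI impI)
    show "l \<in> topspace (Baire1_space X)" using BR by simp
    fix U assume U: "openin (Baire1_space X) U \<and> l \<in> U"
    obtain F e where F: "finite F" "F \<subseteq> topspace X" "e > 0" "nb X l F e \<subseteq> U"
      using openin_Baire1_nb U by metis
    have "\<exists>k\<in>I. \<forall>x\<in>F. \<forall>i\<in>I. le k i \<longrightarrow> \<bar>f i x - l x\<bar> < e"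
      by (rule directed_finite_bound[OF I F(1)]) (use tr in blast, use F BR in blast)
    then obtain k where "k \<in> I" "\<And>i. i \<in> I \<Longrightarrow> le k i \<Longrightarrow> f i \<in> nb X l F e"
      using f by (auto simp: nb_def)
    then show "\<exists>k\<in>I. \<forall>i\<in>I. le k i \<longrightarrow> f i \<in> U"
      using F(4) by blast
  qed
qed

text \<open>Choose indices \<open>k n\<close> beyond which the net varies by less than
  \<open>1 / Suc n\<close>. Any two of them have a common upper bound, so the values at
  \<open>k n\<close> form a Cauchy sequence, whose limit is that of the net.\<close>

lemma real_Cauchy_net_converges:
  fixes a :: "'i \<Rightarrow> real"
  assumes I: "directed_set I le"
    and a: "\<And>e. e > 0 \<Longrightarrow> \<exists>k\<in>I. \<forall>i\<in>I. \<forall>j\<in>I. le k i \<longrightarrow> le k j \<longrightarrow> \<bar>a i - a j\<bar> < e"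
  shows "\<exists>L. \<forall>e>0. \<exists>k\<in>I. \<forall>i\<in>I. le k i \<longrightarrow> \<bar>a i - L\<bar> < e"
proof -
  have "\<exists>k\<in>I. \<forall>i\<in>I. \<forall>j\<in>I. le k i \<longrightarrow> le k j \<longrightarrow> \<bar>a i - a j\<bar> < inverse (real (Suc n))" for n
    by (rule a) simp
  then obtain k where k: "\<And>n. k n \<in> I"
    "\<And>n i j. i \<in> I \<Longrightarrow> j \<in> I \<Longrightarrow> le (k n) i \<Longrightarrow> le (k n) j \<Longrightarrow> \<bar>a i - a j\<bar> < inverse (real (Suc n))"
    by metis
  have refl: "le i i" if "i \<in> I" for i using I that unfolding directed_set_def by blast
  have kk: "\<bar>a (k m) - a (k n)\<bar> < inverse (real (Suc m)) + inverse (real (Suc n))" for m n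
  proof -
    obtain i where i: "i \<in> I" "le (k m) i" "le (k n) i"
      using I k(1) unfolding directed_set_def by meson
    show ?thesis
      using k(2)[OF k(1) i(1) refl[OF k(1)] i(2)] k(2)[OF k(1) i(1) refl[OF k(1)] i(3)] by linarith
  qed
  have small: "\<exists>N. \<forall>n\<ge>N. inverse (real (Suc n)) < e / 2" if "e > 0" for e
    using order_tendstoD(2)[OF LIMSEQ_inverse_real_of_nat, of "e / 2"] that
    by (auto simp: eventually_sequentially)
  have "Cauchy (\<lambda>n. a (k n))"
  proof (rule CauchyI)
    fix e :: real assume "e > 0"
    then obtain N where N: "\<And>n. n \<ge> N \<Longrightarrow> inverse (real (Suc n)) < e / 2" using small by blast
    have "\<bar>a (k m) - a (k n)\<bar> < e" if "m \<ge> N" "n \<ge> N" for m n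
      using kk[of m n] N[OF that(1)] N[OF that(2)] by linarith
    then show "\<exists>M. \<forall>m\<ge>M. \<forall>n\<ge>M. norm (a (k m) - a (k n)) < e" by auto
  qed
  then obtain L where L: "(\<lambda>n. a (k n)) \<longlonglongrightarrow> L"
    using Cauchy_convergent by (auto simp: convergent_def)
  show ?thesis
  proof (intro exI[of _ L] allI impI)
    fix e :: real assume e: "e > 0"
    obtain N where N: "\<And>n. n \<ge> N \<Longrightarrow> inverse (real (Suc n)) < e / 2" using small[OF e] by blast
    obtain M where M: "\<And>n. n \<ge> M \<Longrightarrow> \<bar>a (k n) - L\<bar> < e / 2"
      using LIMSEQ_D[OF L, of "e / 2"] e by auto
    define n where "n = max N M"
    have "\<bar>a i - L\<bar> < e" if "i \<in> I" "le (k n) i" for i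
    proof -
      have "N \<le> n" "M \<le> n" by (simp_all add: n_def)
      then show ?thesis
        using k(2)[OF that(1) k(1) that(2) refl[OF k(1)]] N[of n] M[of n] by linarith
    qed
    then show "\<exists>k\<in>I. \<forall>i\<in>I. le k i \<longrightarrow> \<bar>a i - L\<bar> < e" using k(1) by blast
  qed
qed

lemma full_imp_complete:
  assumes full: "Baire1 X = (topspace X \<rightarrow>\<^sub>E UNIV)"
  shows "complete_function_space (topspace X) (Baire1_space X)"
  unfolding complete_function_space_def
proof (intro allI impI)
  fix I :: "(('a \<Rightarrow> real) set \<times> ('a \<Rightarrow> real)) set" and le f
  assume *: "directed_set I le \<and> Cauchy_net (topspace X) (Baire1_space X) I le f"
  then have I: "directed_set I le" ..
  then have f: "\<And>i. i \<in> I \<Longrightarrow> f i \<in> Baire1 X"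
    and C: "\<And>x e. x \<in> topspace X \<Longrightarrow> e > 0 \<Longrightarrow>
      \<exists>k\<in>I. \<forall>i\<in>I. \<forall>j\<in>I. le k i \<longrightarrow> le k j \<longrightarrow> \<bar>f i x - f j x\<bar> < e"
    using * unfolding Cauchy_net_Baire1_iff[OF I] by blast+
  have "\<exists>L. \<forall>e>0. \<exists>k\<in>I. \<forall>i\<in>I. le k i \<longrightarrow> \<bar>f i x - L\<bar> < e" if "x \<in> topspace X" for x
    by (rule real_Cauchy_net_converges[OF I C[OF that]])
  then obtain L where L: "\<And>x e. x \<in> topspace X \<Longrightarrow> e > 0 \<Longrightarrow> \<exists>k\<in>I. \<forall>i\<in>I. le k i \<longrightarrow> \<bar>f i x - L x\<bar> < e"
    by metis
  have "net_limit (Baire1_space X) I le f (restrict L (topspace X))"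
    using L by (simp add: net_limit_Baire1_iff[OF I f] full)
  then show "\<exists>l. net_limit (Baire1_space X) I le f l" by blast
qed

text \<open>An arbitrary \<open>g\<close> is the limit of its restrictions to finite sets, extended
  by zero. These are of the first class and form a Cauchy net directed by inclusion.\<close>

lemma complete_imp_full:
  assumes X: "metrizable_space X"
    and comp: "complete_function_space (topspace X) (Baire1_space X)"
  shows "Baire1 X = (topspace X \<rightarrow>\<^sub>E UNIV)"
proof
  show "Baire1 X \<subseteq> (topspace X \<rightarrow>\<^sub>E UNIV)" by (auto simp: Baire1_iff PiE_def)
  show "(topspace X \<rightarrow>\<^sub>E UNIV) \<subseteq> Baire1 X"
  proof
    fix g :: "'a \<Rightarrow> real" assume g: "g \<in> topspace X \<rightarrow>\<^sub>E UNIV"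
    define I where "I = {F. finite F \<and> F \<subseteq> topspace X}"
    define f where "f F = (\<lambda>x\<in>topspace X. if x \<in> F then g x else 0)" for F
    have "\<exists>k\<in>I. i \<subseteq> k \<and> j \<subseteq> k" if "i \<in> I" "j \<in> I" for i j
      using that by (intro bexI[of _ "i \<union> j"]) (auto simp: I_def)
    then have I: "directed_set I (\<subseteq>)" by (auto simp: directed_set_def I_def)
    have f: "f F \<in> Baire1 X" if "F \<in> I" for F
      unfolding f_def restrict_in_Baire1
      by (rule baire_one_finite_support[OF X, of F]) (use that in \<open>auto simp: I_def\<close>)
    have "Cauchy_net (topspace X) (Baire1_space X) I (\<subseteq>) f"
      unfolding Cauchy_net_Baire1_iff[OF I]
    proof (intro conjI ballI allI impI f)
      fix x and e :: real assume "x \<in> topspace X" "e > 0"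
      then show "\<exists>k\<in>I. \<forall>i\<in>I. \<forall>j\<in>I. k \<subseteq> i \<longrightarrow> k \<subseteq> j \<longrightarrow> \<bar>f i x - f j x\<bar> < e"
        by (intro bexI[of _ "{x}"]) (auto simp: f_def I_def)
    qed
    \<comment> \<open>The indices here are finite sets of points, a type other than the one fixed in
      the definition of completeness.\<close>
    then obtain l where nl: "net_limit (Baire1_space X) I (\<subseteq>) f l"
      using complete_function_space_net[OF comp I] by blast
    have l: "l \<in> Baire1 X"
      "\<And>x e. x \<in> topspace X \<Longrightarrow> e > 0 \<Longrightarrow> \<exists>k\<in>I. \<forall>i\<in>I. k \<subseteq> i \<longrightarrow> \<bar>f i x - l x\<bar> < e"
      using iffD1[OF net_limit_Baire1_iff[OF I f] nl] by simp_all
    have "l x = g x" if x: "x \<in> topspace X" for x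
    proof (rule ccontr)
      assume "l x \<noteq> g x"
      then obtain k where k: "k \<in> I" "\<And>i. i \<in> I \<Longrightarrow> k \<subseteq> i \<Longrightarrow> \<bar>f i x - l x\<bar> < \<bar>g x - l x\<bar>"
        using l(2)[OF x, of "\<bar>g x - l x\<bar>"] by auto
      \<comment> \<open>At the index \<open>insert x k\<close> the net takes exactly the value
        \<open>g x\<close> at \<open>x\<close>.\<close>
      have "\<bar>f (insert x k) x - l x\<bar> < \<bar>g x - l x\<bar>"
        using k(1) x by (intro k(2)) (auto simp: I_def)
      then show False using x by (simp add: f_def)
    qed
    then have "l = g"
      using g l(1) by (intro extensionalityI[of _ "topspace X"]) (auto simp: Baire1_iff PiE_def)
    then show "g \<in> Baire1 X" using l(1) by simp
  qed
qed

text \<open>If the indicator of \<open>S\<close> is of the first class, then \<open>S\<close> is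
  \<open>G\<^sub>\<delta>\<close> as one of its superlevel sets. In a \<open>Q\<close>-set all
  subsets are \<open>F\<^sub>\<sigma>\<close>, in particular all level sets.\<close>

lemma full_iff_Q_set:
  assumes X: "metrizable_space X"
  shows "Baire1 X = (topspace X \<rightarrow>\<^sub>E UNIV) \<longleftrightarrow> Q_set X"
proof
  assume full: "Baire1 X = (topspace X \<rightarrow>\<^sub>E UNIV)"
  show "Q_set X"
    unfolding Q_set_def
  proof (intro allI impI)
    fix S assume S: "S \<subseteq> topspace X"
    have "restrict (indicat_real S) (topspace X) \<in> Baire1 X" by (simp add: full)
    then have "gdelta_in X {x \<in> topspace X. 1 \<le> indicat_real S x}"
      unfolding restrict_in_Baire1 by (rule baire_one_gdelta_ge)
    moreover have "{x \<in> topspace X. 1 \<le> indicat_real S x} = S"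
      using S by (auto simp: indicator_def split: if_splits)
    ultimately show "gdelta_in X S" by simp
  qed
next
  assume Q: "Q_set X"
  have fs: "fsigma_in X S" if "S \<subseteq> topspace X" for S
    using Q that unfolding Q_set_def by (simp add: fsigma_in_gdelta_in)
  have "baire_one X f" for f
    by (rule baire_one_level_sets[OF metrizable_imp_normal_space[OF X]]) (auto intro: fs)
  then show "Baire1 X = (topspace X \<rightarrow>\<^sub>E UNIV)" by (auto simp: Baire1_iff PiE_def)
qed

section \<open>Sequential completeness and \<sigma>-sets\<close>

lemma directed_set_nat: "directed_set (UNIV :: nat set) (\<le>)"
  unfolding directed_set_def by (auto intro: max.cobounded1 max.cobounded2)

lemma Cauchy_sequence_Baire1_iff:
  "Cauchy_net (topspace X) (Baire1_space X) UNIV (\<le>) f \<longleftrightarrow>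
    (\<forall>n::nat. f n \<in> Baire1 X) \<and> (\<forall>x\<in>topspace X. Cauchy (\<lambda>n. f n x))"
  unfolding Cauchy_net_Baire1_iff[OF directed_set_nat] Cauchy_def dist_real_def by auto

lemma limitin_Baire1_iff:
  assumes "\<And>n. f n \<in> Baire1 X"
  shows "limitin (Baire1_space X) f l sequentially \<longleftrightarrow>
    l \<in> Baire1 X \<and> (\<forall>x\<in>topspace X. (\<lambda>n. f n x) \<longlonglongrightarrow> l x)"
proof -
  have "\<And>g. g \<in> Baire1 X \<Longrightarrow> g \<in> extensional (topspace X)" by (simp add: Baire1_iff)
  then show ?thesis
    using assms
    by (auto simp: Baire1_space_def limitin_subtopology limitin_componentwise PiE_def)
qed

text \<open>In the formula for sublevel sets of a limit the inner intersections are
  \<open>G\<^sub>\<delta>\<close>. In a \<sigma>-set these are \<open>F\<^sub>\<sigma>\<close> by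
  taking complements, and so are their countable unions.\<close>

lemma sigma_set_pointwise_limit:
  assumes X: "metrizable_space X" and \<sigma>: "sigma_set X" and f: "\<And>n::nat. baire_one X (f n)"
    and lim: "\<And>x. x \<in> topspace X \<Longrightarrow> (\<lambda>n. f n x) \<longlonglongrightarrow> l x"
  shows "baire_one X l"
proof (rule baire_one_level_sets[OF metrizable_imp_normal_space[OF X]])
  have fs: "fsigma_in X S" if "gdelta_in X S" for S
  proof -
    have "fsigma_in X (topspace X - S)"
      using that by (intro fsigma_in_diff) auto
    then have "gdelta_in X (topspace X - S)" using \<sigma> by (simp add: sigma_set_def)
    then show ?thesis using gdelta_in_subset[OF that] by (simp add: fsigma_in_gdelta_in)
  qed
  have less: "fsigma_in X {x \<in> topspace X. l x < a}" for a
  proof -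
    have "gdelta_in X (\<Inter>n\<in>{k..}. {x \<in> topspace X. f n x \<le> c})" for k c
      by (intro gdelta_in_Inter) (auto intro: baire_one_gdelta_le f)
    then have "fsigma_in X (\<Inter>n\<in>{k..}. {x \<in> topspace X. f n x \<le> c})" for k c
      by (rule fs)
    then have "fsigma_in X (\<Union>k. \<Inter>n\<in>{k..}. {x \<in> topspace X. f n x \<le> c})" for c
      by (blast intro: fsigma_in_Union)
    then have "fsigma_in X (\<Union>m::nat. \<Union>k. \<Inter>n\<in>{k..}. {x \<in> topspace X. f n x \<le> a - 1 / Suc m})"
      by (intro fsigma_in_Union) blast+
    then show ?thesis
      using limit_sublevel_eq[of "topspace X" f l a] lim by simp
  qed
  fix a b
  have "fsigma_in X (topspace X - {x \<in> topspace X. l x < a})"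
    by (rule fs) (use less in \<open>auto simp: gdelta_in_diff open_imp_gdelta_in\<close>)
  then have "fsigma_in X ((topspace X - {x \<in> topspace X. l x < a}) \<inter> {x \<in> topspace X. l x < b})"
    using less by (rule fsigma_in_Int)
  moreover have "(topspace X - {x \<in> topspace X. l x < a}) \<inter> {x \<in> topspace X. l x < b} =
      {x \<in> topspace X. a \<le> l x \<and> l x < b}" by auto
  ultimately show "fsigma_in X {x \<in> topspace X. a \<le> l x \<and> l x < b}" by simp
qed

text \<open>For the converse write an \<open>F\<^sub>\<sigma>\<close>-set as an ascending union of
  closed sets: their indicators are of the first class and converge pointwise to the indicator of
  the union.\<close>

lemma sequentially_complete_iff_sigma_set:
  assumes X: "metrizable_space X"
  shows "sequentially_complete_function_space (topspace X) (Baire1_space X) \<longleftrightarrow> sigma_set X"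
proof
  assume \<sigma>: "sigma_set X"
  show "sequentially_complete_function_space (topspace X) (Baire1_space X)"
    unfolding sequentially_complete_function_space_def Cauchy_sequence_Baire1_iff
  proof (intro allI impI)
    fix f :: "nat \<Rightarrow> 'a \<Rightarrow> real"
    assume f: "(\<forall>n. f n \<in> Baire1 X) \<and> (\<forall>x\<in>topspace X. Cauchy (\<lambda>n. f n x))"
    define l where "l x = lim (\<lambda>n. f n x)" for x
    have lim: "(\<lambda>n. f n x) \<longlonglongrightarrow> l x" if "x \<in> topspace X" for x
      unfolding l_def using f that Cauchy_convergent convergent_LIMSEQ_iff by blast
    have "baire_one X l"
      by (rule sigma_set_pointwise_limit[OF X \<sigma> _ lim]) (use f in \<open>auto simp: Baire1_iff\<close>)
    then have "restrict l (topspace X) \<in> Baire1 X" by (simp add: restrict_in_Baire1)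
    then show "\<exists>l. limitin (Baire1_space X) f l sequentially"
      using f lim by (intro exI[of _ "restrict l (topspace X)"]) (simp add: limitin_Baire1_iff)
  qed
next
  assume sc: "sequentially_complete_function_space (topspace X) (Baire1_space X)"
  show "sigma_set X"
    unfolding sigma_set_def
  proof (intro allI impI)
    fix S assume "fsigma_in X S"
    then obtain C where C: "\<And>n::nat. closedin X (C n)" "\<And>n. C n \<subseteq> C (Suc n)" "\<Union>(range C) = S"
      unfolding fsigma_in_ascending by blast
    have mono: "C m \<subseteq> C n" if "m \<le> n" for m n using C(2) that by (rule lift_Suc_mono_le)
    define f where "f n = restrict (indicat_real (C n)) (topspace X)" for n
    have f: "f n \<in> Baire1 X" for n
      unfolding f_def restrict_in_Baire1
    proof (rule baire_one_fsigma_pieces[OF metrizable_imp_normal_space[OF X],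
          of "{C n, topspace X - C n}"])
      have "fsigma_in X (topspace X - C n)"
        using C(1)[of n] X by (intro fsigma_in_diff closed_imp_gdelta_in) auto
      then show "fsigma_in X A" if "A \<in> {C n, topspace X - C n}" for A
        using that C(1) closed_imp_fsigma_in by blast
    qed auto
    have lim: "(\<lambda>n. f n x) \<longlonglongrightarrow> indicat_real S x" if x: "x \<in> topspace X" for x
    proof (rule tendsto_eventually)
      show "\<forall>\<^sub>F n in sequentially. f n x = indicat_real S x"
      proof (cases "x \<in> S")
        case True
        then obtain N where "x \<in> C N" using C(3) by blast
        then have "x \<in> C n" if "n \<ge> N" for n using mono[OF that] by blast
        then show ?thesis using x True by (intro eventually_sequentiallyI[of N]) (simp add: f_def)
      next
        case False
        then have "x \<notin> C n" for n using C(3) by blast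
        then show ?thesis using x False by (simp add: f_def)
      qed
    qed
    then have "Cauchy_net (topspace X) (Baire1_space X) UNIV (\<le>) f"
      unfolding Cauchy_sequence_Baire1_iff using f LIMSEQ_imp_Cauchy by blast
    then obtain l where "limitin (Baire1_space X) f l sequentially"
      using sc unfolding sequentially_complete_function_space_def by blast
    then have l: "baire_one X l" "\<And>x. x \<in> topspace X \<Longrightarrow> (\<lambda>n. f n x) \<longlonglongrightarrow> l x"
      using f by (auto simp: limitin_Baire1_iff Baire1_iff)
    have "l x = indicat_real S x" if "x \<in> topspace X" for x
      using LIMSEQ_unique[OF l(2) lim] that by blast
    moreover have "S \<subseteq> topspace X" using closedin_subset[OF C(1)] C(3) by blast
    moreover have "1 \<le> indicat_real S x \<longleftrightarrow> x \<in> S" for x by (cases "x \<in> S") auto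
    ultimately have "{x \<in> topspace X. 1 \<le> l x} = S" by auto
    then show "gdelta_in X S" using baire_one_gdelta_ge[OF l(1), of 1] by simp
  qed
qed

section \<open>The Polish case\<close>

text \<open>Reindexing along the injection \<open>to_nat_on S\<close> maps the separable space of
  real sequences continuously onto this power, for finite and infinite \<open>S\<close>
  alike.\<close>

lemma separable_space_euclideanreal_power:
  assumes "countable S"
  shows "separable_space (product_topology (\<lambda>_. euclideanreal) S)"
proof (rule separable_space_continuous_map_image)
  have "second_countable (euclidean :: (nat \<Rightarrow> real) topology)"
  proof -
    obtain \<B> :: "(nat \<Rightarrow> real) set set" where "countable \<B>" "\<And>C. C \<in> \<B> \<Longrightarrow> open C"
      "\<And>S. open S \<Longrightarrow> \<exists>U. U \<subseteq> \<B> \<and> S = \<Union>U"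
      using univ_second_countable by metis
    then show ?thesis
      unfolding second_countable_def by (intro exI[of _ \<B>]) (simp, metis Union_iff Union_upper subset_iff)
  qed
  then show "separable_space (product_topology (\<lambda>_::nat. euclideanreal) UNIV)"
    by (simp add: euclidean_product_topology second_countable_imp_separable_space)
  show "continuous_map (product_topology (\<lambda>_::nat. euclideanreal) UNIV)
      (product_topology (\<lambda>_. euclideanreal) S) (\<lambda>h. \<lambda>x\<in>S. h (to_nat_on S x))"
    by (auto simp: continuous_map_componentwise intro!: continuous_map_product_projection)
  show "(\<lambda>h. \<lambda>x\<in>S. h (to_nat_on S x)) ` topspace (product_topology (\<lambda>_::nat. euclideanreal) UNIV) =
      topspace (product_topology (\<lambda>_. euclideanreal) S)"
  proof (intro equalityI subsetI)
    fix g :: "'a \<Rightarrow> real" assume g: "g \<in> topspace (product_topology (\<lambda>_. euclideanreal) S)"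
    have "g = (\<lambda>x\<in>S. g (from_nat_into S (to_nat_on S x)))"
      using g assms by (auto simp: PiE_def extensional_def fun_eq_iff)
    then show "g \<in> (\<lambda>h. \<lambda>x\<in>S. h (to_nat_on S x)) ` topspace (product_topology (\<lambda>_::nat. euclideanreal) UNIV)"
      by (intro image_eqI[of _ _ "\<lambda>n. g (from_nat_into S n)"]) auto
  qed auto
qed

lemma countable_imp_Q_set:
  assumes "metrizable_space X" "countable (topspace X)"
  shows "Q_set X"
  unfolding Q_set_def
proof (intro allI impI)
  fix S assume S: "S \<subseteq> topspace X"
  have "countable (topspace X - S)" using assms(2) by simp
  then have "fsigma_in X (topspace X - S)"
    by (intro countable_imp_fsigma_in metrizable_imp_t1_space assms(1)) auto
  then show "gdelta_in X S" using S by (simp add: gdelta_in_fsigma_in)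
qed

text \<open>For countable \<open>X\<close> the space is the whole power. Conversely, take a
  countable neighbourhood base at a function \<open>z\<close>: each of its members contains a basic
  set constraining finitely many points, and these finite sets must cover \<open>X\<close>.\<close>

lemma Polish_iff_countable:
  assumes X: "metrizable_space X"
  shows "Polish_space (Baire1_space X) \<longleftrightarrow> countable (topspace X)"
proof
  assume c: "countable (topspace X)"
  have "Baire1 X = (topspace X \<rightarrow>\<^sub>E UNIV)"
    using full_iff_Q_set[OF X] countable_imp_Q_set[OF X c] by simp
  then have "Baire1_space X = product_topology (\<lambda>_. euclideanreal) (topspace X)"
    unfolding Baire1_space_def by (intro subtopology_superset) simp
  then show "Polish_space (Baire1_space X)"
    using separable_space_euclideanreal_power[OF c] c
    by (auto simp: Polish_space_def completely_metrizable_space_product_topology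
        completely_metrizable_space_euclidean)
next
  assume "Polish_space (Baire1_space X)"
  then have "first_countable (Baire1_space X)"
    unfolding Polish_space_def
    by (blast intro: metrizable_imp_first_countable completely_metrizable_imp_metrizable_space)
  moreover obtain z where z: "z \<in> Baire1 X" using Baire1_zero by blast
  ultimately obtain \<B> where \<B>: "countable \<B>" "\<And>V. V \<in> \<B> \<Longrightarrow> openin (Baire1_space X) V"
    "\<And>U. openin (Baire1_space X) U \<Longrightarrow> z \<in> U \<Longrightarrow> \<exists>V\<in>\<B>. z \<in> V \<and> V \<subseteq> U"
    unfolding first_countable_def topspace_Baire1_space by meson
  have "\<exists>F e. finite F \<and> F \<subseteq> topspace X \<and> e > 0 \<and> nb X z F e \<subseteq> V" if "V \<in> \<B>" "z \<in> V" for V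
    using openin_Baire1_nb[OF \<B>(2)[OF that(1)] that(2)] by metis
  then obtain F e where F: "\<And>V. V \<in> \<B> \<Longrightarrow> z \<in> V \<Longrightarrow> finite (F V)"
    "\<And>V. V \<in> \<B> \<Longrightarrow> z \<in> V \<Longrightarrow> F V \<subseteq> topspace X"
    "\<And>V. V \<in> \<B> \<Longrightarrow> z \<in> V \<Longrightarrow> e V > 0 \<and> nb X z (F V) (e V) \<subseteq> V"
    by metis
  have "topspace X \<subseteq> (\<Union>V\<in>{V\<in>\<B>. z \<in> V}. F V)"
  proof
    fix x assume x: "x \<in> topspace X"
    have "openin (Baire1_space X) (nb X z {x} 1)" using x by (intro openin_nb) auto
    moreover have "z \<in> nb X z {x} 1" using z by (simp add: nb_def)
    ultimately obtain V where V: "V \<in> \<B>" "z \<in> V" "V \<subseteq> nb X z {x} 1" using \<B>(3) by blast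
    \<comment> \<open>If \<open>x\<close> were outside of \<open>F V\<close>, then \<open>f\<close>
      would agree with \<open>z\<close> on \<open>F V\<close> but differ from it by 1 at
      \<open>x\<close>, hence lie in \<open>V\<close> but not in
      \<open>nb X z {x} 1\<close>.\<close>
    obtain f where f: "f \<in> Baire1 X" "\<And>y. y \<in> insert x (F V) \<Longrightarrow> f y = (if y \<in> F V then z y else z y + 1)"
    proof (rule Baire1_interpolate[OF X, where p = "\<lambda>y. if y \<in> F V then z y else z y + 1"])
      show "finite (insert x (F V))" "insert x (F V) \<subseteq> topspace X" using F(1,2)[OF V(1,2)] x by auto
    qed blast
    have "f \<in> nb X z (F V) (e V)" using f F(3)[OF V(1,2)] by (auto simp: nb_def)
    then have "f \<in> nb X z {x} 1" using F(3)[OF V(1,2)] V(3) by blast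
    then have "x \<in> F V" using f(2)[of x] by (auto simp: nb_def split: if_splits)
    then show "x \<in> (\<Union>V\<in>{V\<in>\<B>. z \<in> V}. F V)" using V by blast
  qed
  moreover have "countable (\<Union>V\<in>{V\<in>\<B>. z \<in> V}. F V)"
    using \<B>(1) F(1) by (intro countable_UN) (auto simp: countable_finite)
  ultimately show "countable (topspace X)" by (rule countable_subset)
qed

section \<open>The Choquet game\<close>

text \<open>
  A triple \<open>(p, F, e)\<close> encodes the basic open set \<open>nb X p F e\<close>. The strict inequality in
  \<open>box_refines\<close> makes the closed intervals of the new set lie inside the open ones of the old set.
\<close>

type_synonym 'a box = "('a \<Rightarrow> real) \<times> 'a set \<times> real"

definition box_supp :: "'a box \<Rightarrow> 'a set" where
  "box_supp s = fst (snd s)"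

definition box_set :: "'a topology \<Rightarrow> 'a box \<Rightarrow> ('a \<Rightarrow> real) set" where
  "box_set X s = nb X (fst s) (box_supp s) (snd (snd s))"

definition valid_box :: "'a topology \<Rightarrow> 'a box \<Rightarrow> bool" where
  "valid_box X s \<longleftrightarrow> finite (box_supp s) \<and> box_supp s \<subseteq> topspace X \<and> snd (snd s) > 0"

definition box_refines :: "'a box \<Rightarrow> 'a box \<Rightarrow> bool" where
  "box_refines s t \<longleftrightarrow> box_supp s \<subseteq> box_supp t \<and>
     (\<forall>x\<in>box_supp s. \<bar>fst t x - fst s x\<bar> + snd (snd t) < snd (snd s))"

lemma openin_box_set:
  "valid_box X s \<Longrightarrow> openin (Baire1_space X) (box_set X s)"
  by (simp add: valid_box_def box_set_def openin_nb)

lemma box_set_nonempty: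
  "metrizable_space X \<Longrightarrow> valid_box X s \<Longrightarrow> box_set X s \<noteq> {}"
  by (simp add: valid_box_def box_set_def nb_nonempty)

lemma ex_refinement:
  assumes s: "valid_box X s" and U: "openin (Baire1_space X) U" "U \<inter> box_set X s \<noteq> {}"
  shows "\<exists>t. valid_box X t \<and> box_refines s t \<and> box_set X t \<subseteq> U"
proof -
  obtain p' F' e' where "finite F'" "box_supp s \<subseteq> F'" "F' \<subseteq> topspace X" "e' > 0"
    "\<And>x. x \<in> box_supp s \<Longrightarrow> \<bar>p' x - fst s x\<bar> + e' < snd (snd s)" "nb X p' F' e' \<subseteq> U"
    using nb_refine[OF _ _ U(1), of "box_supp s" "fst s" "snd (snd s)"] s U(2)
    unfolding valid_box_def box_set_def by metis
  then show ?thesis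
    by (intro exI[of _ "(p', F', e')"]) (simp add: valid_box_def box_refines_def box_set_def box_supp_def)
qed

text \<open>Nested boxes determine values on their supports only, and the resulting \<open>g\<close>
  may fail to be of the first class. So the conclusion concerns all functions of the first class
  with these values on the support.\<close>

lemma box_refines_limit:
  assumes s: "\<And>n. valid_box X (s n)" "\<And>n. box_refines (s n) (s (Suc n))"
  obtains g where "\<And>n f. f \<in> Baire1 X \<Longrightarrow> (\<And>x. x \<in> box_supp (s n) \<Longrightarrow> f x = g x) \<Longrightarrow> f \<in> box_set X (s n)"
proof -
  obtain g where g: "\<And>n x. x \<in> box_supp (s n) \<Longrightarrow> \<bar>g x - fst (s n) x\<bar> < snd (snd (s n))"
  proof (rule nested_nb_limit)
    show "snd (snd (s n)) > 0" for n using s(1) by (simp add: valid_box_def)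
    show "box_supp (s n) \<subseteq> box_supp (s (Suc n))"
      "\<And>x. x \<in> box_supp (s n) \<Longrightarrow>
        \<bar>fst (s (Suc n)) x - fst (s n) x\<bar> + snd (snd (s (Suc n))) < snd (snd (s n))" for n
      using s(2)[of n] by (simp_all add: box_refines_def)
  qed blast
  show thesis
    by (rule that[of g]) (use g in \<open>simp add: box_set_def nb_def\<close>)
qed

text \<open>Nonempty answers with a box inside the last move that refines the previous box; folding
  over the list of moves recovers the current box. The supports unite to a countable set, which is
  \<open>G\<^sub>\<delta>\<close>, so the limit values extended by zero are of the first
  class.\<close>

lemma lambda_set_imp_Choquet:
  assumes X: "metrizable_space X" and \<lambda>: "lambda_set X"
  shows "Choquet_space (Baire1_space X)"
proof -
  define step where "step s U = (SOME t. valid_box X t \<and> box_refines s t \<and> box_set X t \<subseteq> U)" for s U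
  \<comment> \<open>The box with empty support is all of \<open>Baire1 X\<close>, so every first
    move of Empty lies inside it.\<close>
  define s0 :: "'a box" where "s0 = (\<lambda>_. 0, {}, 1)"
  have s0: "valid_box X s0" "box_set X s0 = Baire1 X"
    by (simp_all add: s0_def valid_box_def box_set_def box_supp_def nb_def)
  have step: "valid_box X (step s U) \<and> box_refines s (step s U) \<and> box_set X (step s U) \<subseteq> U"
    if "valid_box X s" "openin (Baire1_space X) U" "U \<noteq> {}" "U \<subseteq> box_set X s" for s U
    unfolding step_def by (rule someI_ex, rule ex_refinement) (use that in auto)
  define \<sigma> where "\<sigma> l = box_set X (foldl step s0 l)" for l
  have "winning_strategy_Nonempty (Baire1_space X) \<sigma>"
    unfolding winning_strategy_Nonempty_def
  proof (rule allI)
    fix U :: "nat \<Rightarrow> ('a \<Rightarrow> real) set"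
    define st where "st n = foldl step s0 (map U [0..<n])" for n
    have st_Suc: "st (Suc n) = step (st n) (U n)" for n by (simp add: st_def)
    have reply: "strategy_reply \<sigma> U n = box_set X (st (Suc n))" for n
      unfolding strategy_reply_def \<sigma>_def st_def ..
    let ?legal = "legal_Empty_move (Baire1_space X) \<sigma> U"
    have inv: "valid_box X (st n) \<and> valid_box X (st (Suc n)) \<and> box_refines (st n) (st (Suc n)) \<and>
        box_set X (st (Suc n)) \<subseteq> U n" if "\<forall>k\<le>n. ?legal k" for n
      using that
    proof (induction n)
      case 0
      have st0: "st 0 = s0" by (simp add: st_def)
      have "openin (Baire1_space X) (U 0)" "U 0 \<noteq> {}"
        using 0 by (auto simp: legal_Empty_move_def)
      moreover have "U 0 \<subseteq> box_set X s0"
        using openin_subset[OF \<open>openin (Baire1_space X) (U 0)\<close>] s0(2) by simp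
      ultimately show ?case using step[OF s0(1)] s0(1) by (simp add: st_Suc st0)
    next
      case (Suc n)
      then have v: "valid_box X (st (Suc n))" by simp
      have "?legal (Suc n)" using Suc.prems by blast
      then have "openin (Baire1_space X) (U (Suc n))" "U (Suc n) \<noteq> {}"
        "U (Suc n) \<subseteq> box_set X (st (Suc n))"
        by (auto simp: legal_Empty_move_def reply)
      then show ?case using step[OF v] v by (simp add: st_Suc[of "Suc n"])
    qed
    have moves: "openin (Baire1_space X) (strategy_reply \<sigma> U n) \<and> strategy_reply \<sigma> U n \<noteq> {} \<and>
        strategy_reply \<sigma> U n \<subseteq> U n" if "\<forall>k\<le>n. ?legal k" for n
      using inv[OF that] unfolding reply by (simp add: openin_box_set box_set_nonempty[OF X])
    have "(\<Inter>n. strategy_reply \<sigma> U n) \<noteq> {}" if "\<forall>n. ?legal n"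
    proof -
      have v: "valid_box X (st n)" and r: "box_refines (st n) (st (Suc n))" for n
        using inv that by blast+
      obtain g where g: "\<And>n f. f \<in> Baire1 X \<Longrightarrow> (\<And>x. x \<in> box_supp (st n) \<Longrightarrow> f x = g x) \<Longrightarrow>
          f \<in> box_set X (st n)"
        using box_refines_limit[where s = st, OF v r] by metis
      define D where "D = (\<Union>n. box_supp (st n))"
      have D: "countable D" "D \<subseteq> topspace X"
        using v by (auto simp: D_def valid_box_def intro: countable_finite)
      define f where "f = (\<lambda>x\<in>topspace X. if x \<in> D then g x else 0)"
      have "f \<in> Baire1 X"
        unfolding f_def restrict_in_Baire1
        by (rule baire_one_countable_support[OF X, of D]) (use D \<lambda> in \<open>auto simp: lambda_set_def\<close>)
      then have "f \<in> box_set X (st n)" for n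
        by (rule g) (use D(2) in \<open>auto simp: f_def D_def\<close>)
      then show ?thesis unfolding reply by blast
    qed
    then show "(\<forall>n. (\<forall>k\<le>n. ?legal k) \<longrightarrow> openin (Baire1_space X) (strategy_reply \<sigma> U n) \<and>
        strategy_reply \<sigma> U n \<noteq> {} \<and> strategy_reply \<sigma> U n \<subseteq> U n) \<and>
        ((\<forall>n. ?legal n) \<longrightarrow> (\<Inter>n. strategy_reply \<sigma> U n) \<noteq> {})"
      using moves by blast
  qed
  then show ?thesis
    using Baire1_zero unfolding Choquet_space_def by auto
qed

section \<open>Extracting \<open>G\<^sub>\<delta>\<close>-sets from a winning strategy\<close>

text \<open>\<open>V n\<close> is the set in which Empty has to make move \<open>n\<close>; starting
  it with the whole space treats the first move like the others. Legality follows by strong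
  induction, as the replies to legal moves are nonempty and open.\<close>

lemma Choquet_run:
  assumes \<sigma>: "winning_strategy_Nonempty Y \<sigma>" and Y: "topspace Y \<noteq> {}"
    and V: "V 0 = topspace Y" "\<And>n. V (Suc n) = strategy_reply \<sigma> U n"
    and U: "\<And>n. openin Y (V n) \<Longrightarrow> V n \<noteq> {} \<Longrightarrow> openin Y (U n) \<and> U n \<noteq> {} \<and> U n \<subseteq> V n"
  shows "\<exists>f\<in>topspace Y. \<forall>n. f \<in> U n"
proof -
  have reply: "openin Y (V (Suc n)) \<and> V (Suc n) \<noteq> {} \<and> V (Suc n) \<subseteq> U n"
    if "\<forall>k\<le>n. legal_Empty_move Y \<sigma> U k" for n
    using \<sigma> that unfolding winning_strategy_Nonempty_def V(2) by blast
  have all: "legal_Empty_move Y \<sigma> U n" for n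
  proof (induction n rule: less_induct)
    case (less n)
    have "openin Y (V n) \<and> V n \<noteq> {}"
    proof (cases n)
      case 0
      then show ?thesis using V(1) Y by simp
    next
      case (Suc m)
      then show ?thesis using reply[of m] less.IH by auto
    qed
    then show ?case using U[of n] V(2) unfolding legal_Empty_move_def by auto
  qed
  have "(\<Inter>n. strategy_reply \<sigma> U n) \<noteq> {}"
    using \<sigma>[unfolded winning_strategy_Nonempty_def, THEN spec, of U, THEN conjunct2] all by blast
  then obtain f where f: "\<And>n. f \<in> strategy_reply \<sigma> U n"
    by blast
  have "f \<in> U n" for n
    using f[of n] reply[of n] all V(2) by blast
  moreover have "f \<in> topspace Y"
    using f[of 0] reply[of 0] all V(2) openin_subset by blast
  ultimately show ?thesis by blast
qed

lemma Baire1_open_unconstrained: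
  assumes U: "openin (Baire1_space X) U" "U \<noteq> {}"
  shows "\<exists>F. finite F \<and> F \<subseteq> topspace X \<and>
    (\<exists>p\<in>Baire1 X. \<forall>f\<in>Baire1 X. (\<forall>x\<in>F. f x = p x) \<longrightarrow> f \<in> U)"
proof -
  obtain p where p: "p \<in> U" using U(2) by blast
  obtain F e where "finite F" "F \<subseteq> topspace X" "e > 0" "nb X p F e \<subseteq> U"
    using openin_Baire1_nb[OF U(1) p] .
  moreover have "p \<in> Baire1 X" using p openin_subset[OF U(1)] by auto
  ultimately show ?thesis by (intro exI[of _ F] conjI bexI[of _ p]) (auto simp: nb_def subset_iff)
qed

text \<open>A chosen finite set of points such that, for suitable values there, all other values are
  free within \<open>U\<close>. The default \<open>{}\<close> makes finiteness and inclusion hold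
  for every \<open>U\<close>.\<close>

definition supp :: "'a topology \<Rightarrow> ('a \<Rightarrow> real) set \<Rightarrow> 'a set" where
  "supp X U = (if openin (Baire1_space X) U \<and> U \<noteq> {} then
     (SOME F. finite F \<and> F \<subseteq> topspace X \<and>
       (\<exists>p\<in>Baire1 X. \<forall>f\<in>Baire1 X. (\<forall>x\<in>F. f x = p x) \<longrightarrow> f \<in> U)) else {})"

lemma
  shows finite_supp: "finite (supp X U)"
    and supp_subset: "supp X U \<subseteq> topspace X"
    and supp_free: "openin (Baire1_space X) U \<Longrightarrow> U \<noteq> {} \<Longrightarrow>
      \<exists>p\<in>Baire1 X. \<forall>f\<in>Baire1 X. (\<forall>x\<in>supp X U. f x = p x) \<longrightarrow> f \<in> U"
  using someI_ex[OF Baire1_open_unconstrained[of X U]] by (auto simp: supp_def)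

text \<open>Values at points of \<open>supp X V\<close> may be dictated by \<open>V\<close>; forcing
  large ones only at the remaining points keeps the move nonempty.\<close>

definition large :: "'a topology \<Rightarrow> ('a \<Rightarrow> real) set \<Rightarrow> 'a set \<Rightarrow> nat \<Rightarrow> ('a \<Rightarrow> real) set" where
  "large X V G n = {f \<in> V. \<forall>x\<in>G - supp X V. real n < \<bar>f x\<bar>}"

lemma large_legal:
  assumes X: "metrizable_space X" and G: "finite G" "G \<subseteq> topspace X"
    and V: "openin (Baire1_space X) V" "V \<noteq> {}"
  shows "openin (Baire1_space X) (large X V G n) \<and> large X V G n \<noteq> {} \<and> large X V G n \<subseteq> V"
proof (intro conjI)
  have "openin (Baire1_space X) {f \<in> Baire1 X. \<forall>x\<in>G - supp X V. f x \<in> {y. real n < \<bar>y\<bar>}}"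
    using G by (intro openin_Baire1_box open_Collect_less continuous_intros) auto
  then have "openin (Baire1_space X)
      (V \<inter> {f \<in> Baire1 X. \<forall>x\<in>G - supp X V. f x \<in> {y. real n < \<bar>y\<bar>}})"
    using V(1) by (rule openin_Int[rotated])
  moreover have "V \<inter> {f \<in> Baire1 X. \<forall>x\<in>G - supp X V. f x \<in> {y. real n < \<bar>y\<bar>}} = large X V G n"
    using openin_subset[OF V(1)] by (auto simp: large_def)
  ultimately show "openin (Baire1_space X) (large X V G n)" by simp
  obtain p where p: "\<And>f. f \<in> Baire1 X \<Longrightarrow> (\<forall>x\<in>supp X V. f x = p x) \<Longrightarrow> f \<in> V"
    using supp_free[OF V] by blast
  obtain f where f: "f \<in> Baire1 X"
    "\<And>x. x \<in> G \<union> supp X V \<Longrightarrow> f x = (if x \<in> supp X V then p x else real n + 1)"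
  proof (rule Baire1_interpolate[OF X, where p = "\<lambda>x. if x \<in> supp X V then p x else real n + 1"])
    show "finite (G \<union> supp X V)" "G \<union> supp X V \<subseteq> topspace X"
      using G supp_subset[of X V] by (simp_all add: finite_supp)
  qed blast
  have "f \<in> large X V G n" using p[OF f(1)] f(2) by (auto simp: large_def)
  then show "large X V G n \<noteq> {}" by blast
qed (auto simp: large_def)

text \<open>
  Empty plays two runs against the winning strategy in parallel, forcing large values at every
  point that is still free. A point constrained by Nonempty in one run is free in the other when
  it first occurs there, so the sum of the absolute values of the two outcomes is finite-to-one
  on each countable set \<open>D\<close> that Empty brings into play.
\<close>

lemma Choquet_imp_lambda_set:
  assumes X: "metrizable_space X" and Ch: "Choquet_space (Baire1_space X)"
  shows "lambda_set X"
  unfolding lambda_set_def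
proof (intro allI impI)
  fix D assume D: "D \<subseteq> topspace X \<and> countable D"
  show "gdelta_in X D"
  proof (cases "D = {}")
    case False
    define d where "d = from_nat_into D"
    have d: "range d = D" "\<And>n. d n \<in> topspace X"
      using D False by (auto simp: d_def range_from_nat_into from_nat_into subset_iff)
    obtain \<sigma> where \<sigma>: "winning_strategy_Nonempty (Baire1_space X) \<sigma>"
      using Ch by (auto simp: Choquet_space_def)
    \<comment> \<open>The empty list is the start of a run, where Empty may move anywhere.\<close>
    define cur where "cur l = (if l = [] then Baire1 X else \<sigma> l)" for l
    define move1 where "move1 n l l' = large X (cur l) (insert (d n) (supp X (cur l'))) n" for n l l'
    define move2 where "move2 n l l' = large X (cur l) (supp X (cur l')) n" for n l l'
    \<comment> \<open>Both histories grow together; the move in the second run already sees the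
      reply to the new move in the first.\<close>
    define H where "H = rec_nat ([], [])
      (\<lambda>n (l, l'). (l @ [move1 n l l'], l' @ [move2 n l' (l @ [move1 n l l'])]))"
    define U1 where "U1 n = move1 n (fst (H n)) (snd (H n))" for n
    define U2 where "U2 n = move2 n (snd (H n)) (fst (H (Suc n)))" for n
    have H: "H n = (map U1 [0..<n], map U2 [0..<n])" for n
    proof (induction n)
      case (Suc n)
      have "H (Suc n) = (fst (H n) @ [U1 n], snd (H n) @ [U2 n])"
        by (simp add: U1_def U2_def) (simp add: H_def split: prod.splits)
      then show ?case using Suc by simp
    qed (simp add: H_def)
    define V1 where "V1 n = cur (map U1 [0..<n])" for n
    define V2 where "V2 n = cur (map U2 [0..<n])" for n
    have V0: "V1 0 = Baire1 X" "V2 0 = Baire1 X" by (simp_all add: V1_def V2_def cur_def)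
    have V_Suc: "V1 (Suc n) = strategy_reply \<sigma> U1 n" "V2 (Suc n) = strategy_reply \<sigma> U2 n" for n
      by (simp_all add: V1_def V2_def cur_def strategy_reply_def)
    have U1: "U1 n = large X (V1 n) (insert (d n) (supp X (V2 n))) n" for n
      by (simp only: U1_def move1_def H V1_def V2_def fst_conv snd_conv)
    have U2: "U2 n = large X (V2 n) (supp X (V1 (Suc n))) n" for n
      by (simp only: U2_def move2_def H V1_def V2_def fst_conv snd_conv)
    have ne: "topspace (Baire1_space X) \<noteq> {}" using Ch by (simp add: Choquet_space_def)
    have legal1: "openin (Baire1_space X) (U1 n) \<and> U1 n \<noteq> {} \<and> U1 n \<subseteq> V1 n"
      if "openin (Baire1_space X) (V1 n)" "V1 n \<noteq> {}" for n
      unfolding U1 using d(2) that by (intro large_legal[OF X]) (simp_all add: finite_supp supp_subset)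
    have legal2: "openin (Baire1_space X) (U2 n) \<and> U2 n \<noteq> {} \<and> U2 n \<subseteq> V2 n"
      if "openin (Baire1_space X) (V2 n)" "V2 n \<noteq> {}" for n
      unfolding U2 using that by (intro large_legal[OF X]) (simp_all add: finite_supp supp_subset)
    obtain f1 where f1: "f1 \<in> Baire1 X" "\<And>n. f1 \<in> U1 n"
      using Choquet_run[OF \<sigma> ne, of V1 U1] V0 V_Suc legal1 by auto
    obtain f2 where f2: "f2 \<in> Baire1 X" "\<And>n. f2 \<in> U2 n"
      using Choquet_run[OF \<sigma> ne, of V2 U2] V0 V_Suc legal2 by auto
    have d1: "d n \<in> supp X (V1 n) \<or> real n < \<bar>f1 (d n)\<bar>" for n
      using f1(2)[of n] by (auto simp: U1 large_def)
    have back1: "x \<in> supp X (V1 n) \<or> real n < \<bar>f1 x\<bar>" if "x \<in> supp X (V2 n)" for x n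
      using f1(2)[of n] that by (auto simp: U1 large_def)
    have back2: "x \<in> supp X (V2 n) \<or> real n < \<bar>f2 x\<bar>" if "x \<in> supp X (V1 (Suc n))" for x n
      using f2(2)[of n] that by (auto simp: U2 large_def)
    \<comment> \<open>At stages beyond \<open>m\<close> the bounds on \<open>f1 x\<close> and
      \<open>f2 x\<close> exclude the second alternatives of \<open>back1\<close> and
      \<open>back2\<close>. So a constraint on \<open>x\<close> passes back and forth between the
      runs down to stage \<open>Suc m\<close>.\<close>
    have descend: "x \<in> supp X (V1 (Suc m))"
      if "x \<in> supp X (V1 (Suc m + k))" "\<bar>f1 x\<bar> \<le> m" "\<bar>f2 x\<bar> \<le> m" for x k and m :: nat
      using that
    proof (induction k)
      case (Suc k)
      have "x \<in> supp X (V2 (Suc m + k))" using back2[of x "Suc m + k"] Suc.prems by auto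
      then have "x \<in> supp X (V1 (Suc m + k))" using back1[of x "Suc m + k"] Suc.prems by auto
      then show ?case using Suc by blast
    qed simp
    define f where "f x = \<bar>f1 x\<bar> + \<bar>f2 x\<bar>" for x
    show ?thesis
    proof (rule gdelta_in_of_finite_bounded_parts[OF X])
      show "baire_one X f"
        unfolding f_def using f1(1) f2(1) by (intro baire_one_add baire_one_abs) (auto simp: Baire1_iff)
      fix m :: nat
      \<comment> \<open>A point \<open>d n\<close> with \<open>n > m\<close> was constrained when
        its turn came, by \<open>d1\<close>, and descends to stage \<open>Suc m\<close>; the points
        with \<open>n \<le> m\<close> are listed separately.\<close>
      have "{x\<in>D. \<bar>f x\<bar> \<le> m} \<subseteq> supp X (V1 (Suc m)) \<union> d ` {..m}"
      proof
        fix x assume "x \<in> {x\<in>D. \<bar>f x\<bar> \<le> m}"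
        then obtain n where n: "x = d n" "\<bar>f1 x\<bar> \<le> m" "\<bar>f2 x\<bar> \<le> m"
          using d(1) by (auto simp: f_def)
        show "x \<in> supp X (V1 (Suc m)) \<union> d ` {..m}"
        proof (cases "n \<le> m")
          case False
          then obtain k where k: "n = Suc m + k"
            using less_iff_Suc_add[of m n] by auto
          have "x \<in> supp X (V1 n)" using d1[of n] n False by auto
          then show ?thesis using descend n k by blast
        qed (use n in auto)
      qed
      then show "finite {x\<in>D. \<bar>f x\<bar> \<le> m}"
        by (rule finite_subset) (simp add: finite_supp)
    qed (use D in auto)
  qed simp
qed

section \<open>The Baire property\<close>

lemma finite_disjoint_family_meets:
  assumes "disjoint_family M" "finite F"
  shows "finite {n::nat. M n \<inter> F \<noteq> {}}"
proof (rule finite_subset)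
  show "{n. M n \<inter> F \<noteq> {}} \<subseteq> (\<Union>x\<in>F. {n. x \<in> M n})" by auto
  have "finite {n. x \<in> M n}" for x
  proof (cases "\<exists>n. x \<in> M n")
    case True
    then obtain n where "x \<in> M n" by blast
    then have "{n. x \<in> M n} \<subseteq> {n}"
      using assms(1) by (auto simp: disjoint_family_on_def)
    then show ?thesis by (rule finite_subset) simp
  qed simp
  then show "finite (\<Union>x\<in>F. {n. x \<in> M n})" using assms(2) by blast
qed

text \<open>The functions exceeding \<open>k\<close> in absolute value on some \<open>M n\<close>
  with \<open>n \<ge> k\<close> form an open set \<open>Q k\<close>. It is dense because a finite
  set of constrained points meets only finitely many \<open>M n\<close>. A function in all
  \<open>Q k\<close> selects infinitely many \<open>M n\<close>, and its bounded parts on their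
  union are finite.\<close>

lemma Baire_imp_kappa_set:
  assumes X: "metrizable_space X" and B: "Baire_space (Baire1_space X)"
  shows "kappa_set X"
  unfolding kappa_set_def
proof (intro allI impI)
  fix M :: "nat \<Rightarrow> 'a set"
  assume *: "(\<forall>n. finite (M n) \<and> M n \<subseteq> topspace X) \<and> disjoint_family M"
  then have M: "\<And>n. finite (M n)" "\<And>n. M n \<subseteq> topspace X" "disjoint_family M" by auto
  define W where "W k n = {f \<in> Baire1 X. \<forall>x\<in>M n. f x \<in> {y. real k < \<bar>y\<bar>}}" for k n :: nat
  define Q where "Q k = (\<Union>n\<in>{k..}. W k n)" for k
  have "openin (Baire1_space X) (W k n)" for k n
    unfolding W_def using M by (intro openin_Baire1_box open_Collect_less continuous_intros) auto
  then have op: "openin (Baire1_space X) (Q k)" for k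
    unfolding Q_def by auto
  have dense: "Baire1_space X closure_of Q k = topspace (Baire1_space X)" for k
    unfolding dense_intersects_open
  proof (intro allI impI)
    fix T assume T: "openin (Baire1_space X) T \<and> T \<noteq> {}"
    then obtain F p where F: "finite F" "F \<subseteq> topspace X"
      "\<And>f. f \<in> Baire1 X \<Longrightarrow> (\<forall>x\<in>F. f x = p x) \<Longrightarrow> f \<in> T"
      using Baire1_open_unconstrained[of X T] by metis
    have "infinite ({k..} - {n. M n \<inter> F \<noteq> {}})"
      using finite_disjoint_family_meets[OF M(3) F(1)] infinite_Ici by (rule Diff_infinite_finite)
    then obtain n where n: "n \<ge> k" "M n \<inter> F = {}"
      by (metis (mono_tags, lifting) Diff_iff atLeast_iff finite.emptyI ex_in_conv mem_Collect_eq)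
    obtain f where f: "f \<in> Baire1 X" "\<And>x. x \<in> M n \<union> F \<Longrightarrow> f x = (if x \<in> F then p x else real k + 1)"
    proof (rule Baire1_interpolate[OF X, where p = "\<lambda>x. if x \<in> F then p x else real k + 1"])
      show "finite (M n \<union> F)" "M n \<union> F \<subseteq> topspace X" using M F by auto
    qed blast
    have "f \<in> T" using F(3)[OF f(1)] f(2) by simp
    moreover have "f \<in> W k n" using f n(2) by (auto simp: W_def)
    ultimately show "Q k \<inter> T \<noteq> {}" using n(1) by (auto simp: Q_def)
  qed
  have "Baire1_space X closure_of (\<Inter>k. Q k) = topspace (Baire1_space X)"
    using B op dense unfolding Baire_space_def by blast
  moreover have "topspace (Baire1_space X) \<noteq> {}" using Baire1_zero by auto
  ultimately have "(\<Inter>k. Q k) \<noteq> {}" by (metis closure_of_empty)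
  then obtain f where "\<And>k. f \<in> Q k" by blast
  then have "\<exists>n\<ge>k. f \<in> W k n" for k by (auto simp: Q_def)
  then obtain n where n: "\<And>k. n k \<ge> k" "\<And>k. f \<in> W k (n k)" by metis
  define A where "A = range n"
  have "infinite A"
    unfolding A_def infinite_nat_iff_unbounded_le using n(1) by blast
  moreover have "gdelta_in X (\<Union>i\<in>A. M i)"
  proof (rule gdelta_in_of_finite_bounded_parts[OF X])
    show "baire_one X f" using n(2)[of 0] by (simp add: W_def Baire1_iff)
    fix m :: nat
    have "{x \<in> \<Union>i\<in>A. M i. \<bar>f x\<bar> \<le> m} \<subseteq> (\<Union>k\<in>{..m}. M (n k))"
    proof
      fix x assume "x \<in> {x \<in> \<Union>i\<in>A. M i. \<bar>f x\<bar> \<le> m}"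
      then obtain k where "x \<in> M (n k)" "\<bar>f x\<bar> \<le> m" by (auto simp: A_def)
      moreover then have "real k < \<bar>f x\<bar>" using n(2)[of k] by (auto simp: W_def)
      ultimately show "x \<in> (\<Union>k\<in>{..m}. M (n k))" by auto
    qed
    then show "finite {x \<in> \<Union>i\<in>A. M i. \<bar>f x\<bar> \<le> m}"
      by (rule finite_subset) (simp add: M(1))
  qed (use M(2) in auto)
  ultimately show "\<exists>A. infinite A \<and> gdelta_in X (\<Union>n\<in>A. M n)" by blast
qed

section \<open>From \<kappa>-sets to the Baire property\<close>

text \<open>Replacing the values below \<open>(1/2) ^ k\<close> in absolute value by zero leaves a
  finite support, and these cut-offs converge uniformly.\<close>

lemma baire_one_vanishing_at_infinity:
  assumes X: "metrizable_space X" and fin: "\<And>m::nat. finite {x \<in> topspace X. \<bar>f x\<bar> \<ge> 1 / Suc m}"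
  shows "baire_one X f"
proof -
  define h where "h k x = (if (1/2) ^ k \<le> \<bar>f x\<bar> then f x else 0)" for k :: nat and x
  have "baire_one X (h k)" for k
  proof (rule baire_one_finite_support[OF X, of "{x \<in> topspace X. (1/2) ^ k \<le> \<bar>f x\<bar>}"])
    \<comment> \<open>With \<open>m = 2 ^ k - 1\<close> the threshold \<open>1 / Suc m\<close>
      becomes \<open>(1/2) ^ k\<close>.\<close>
    have "real (Suc (2 ^ k - 1)) = 2 ^ k" by simp
    then show "finite {x \<in> topspace X. (1/2) ^ k \<le> \<bar>f x\<bar>}"
      using fin[of "2 ^ k - 1"] by (simp only: power_one_over)
  qed (auto simp: h_def)
  moreover have "\<bar>f x - h k x\<bar> \<le> (1/2) ^ k" for k x
    by (simp add: h_def)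
  ultimately show ?thesis by (rule baire_one_uniform_limit)
qed

text \<open>Partial intersections make the sequence of dense open sets decreasing, so that
  membership at infinitely many stages gives membership in all sets.\<close>

lemma dense_open_INT_atMost:
  assumes "\<And>n::nat. openin Y (U n) \<and> Y closure_of U n = topspace Y"
  shows "openin Y (\<Inter>k\<le>n. U k) \<and> Y closure_of (\<Inter>k\<le>n. U k) = topspace Y"
proof (induction n)
  case (Suc n)
  have eq: "(\<Inter>k\<le>Suc n. U k) = U (Suc n) \<inter> (\<Inter>k\<le>n. U k)"
    by (simp add: atMost_Suc)
  have "U (Suc n) \<inter> (\<Inter>k\<le>n. U k) \<inter> T \<noteq> {}" if T: "openin Y T" "T \<noteq> {}" for T
  proof -
    have "openin Y ((\<Inter>k\<le>n. U k) \<inter> T)" "(\<Inter>k\<le>n. U k) \<inter> T \<noteq> {}"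
      using Suc T by (auto simp: dense_intersects_open)
    then have "U (Suc n) \<inter> ((\<Inter>k\<le>n. U k) \<inter> T) \<noteq> {}"
      using assms[of "Suc n"] unfolding dense_intersects_open by blast
    then show ?thesis by blast
  qed
  then show ?case
    unfolding eq dense_intersects_open using Suc assms[of "Suc n"] by blast
qed (use assms[of 0] in simp)

text \<open>
  The boxes \<open>st n a\<close> are built so that, for every set \<open>A\<close> of stages, the stages \<open>n \<in> A\<close> enter the
  \<open>n\<close>-th dense open set and force values below \<open>1 / Suc n\<close> at the points that earlier stages
  constrained for other sets only. For an infinite \<open>A\<close> provided by the \<open>\<kappa>\<close>-property, the limit
  function vanishes at infinity outside of the \<open>G\<^sub>\<delta>\<close>-set \<open>\<Union>n\<in>A. M n\<close>, hence it is of the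
  first class.
\<close>

lemma kappa_set_imp_Baire:
  assumes X: "metrizable_space X" and \<kappa>: "kappa_set X"
  shows "Baire_space (Baire1_space X)"
  unfolding Baire_space_def
proof (intro allI impI)
  fix U0 :: "nat \<Rightarrow> ('a \<Rightarrow> real) set"
  assume U0: "\<forall>n. openin (Baire1_space X) (U0 n) \<and>
    Baire1_space X closure_of U0 n = topspace (Baire1_space X)"
  define U where "U n = (\<Inter>k\<le>n. U0 k)" for n
  have U: "openin (Baire1_space X) (U n)"
    "\<And>T. openin (Baire1_space X) T \<Longrightarrow> T \<noteq> {} \<Longrightarrow> U n \<inter> T \<noteq> {}" for n
    using dense_open_INT_atMost[of "Baire1_space X" U0 n] U0
    unfolding U_def dense_intersects_open by blast+
  show "Baire1_space X closure_of (\<Inter>n. U0 n) = topspace (Baire1_space X)"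
    unfolding dense_intersects_open
  proof (intro allI impI)
    fix W assume W: "openin (Baire1_space X) W \<and> W \<noteq> {}"
    have "valid_box X (\<lambda>_. 0, {}, 1)" "box_set X (\<lambda>_. 0, {}, 1) = Baire1 X"
      by (simp_all add: valid_box_def box_set_def box_supp_def nb_def)
    then obtain s0 where s0: "valid_box X s0" "box_set X s0 \<subseteq> W"
      using ex_refinement[of X "(\<lambda>_. 0, {}, 1)" W] W openin_subset[of "Baire1_space X" W] by force
    \<comment> \<open>\<open>box_refines\<close> demands shrinking intervals, so a stage outside of
      \<open>a\<close> cannot repeat the old box. Halving the radius constrains no new
      points.\<close>
    define halve :: "'a box \<Rightarrow> 'a box" where "halve s = (fst s, box_supp s, snd (snd s) / 2)" for s
    have supp_halve: "box_supp (halve s) = box_supp s" for s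
      by (simp add: halve_def box_supp_def)
    have halve: "valid_box X (halve s) \<and> box_refines s (halve s)" if "valid_box X s" for s
      using that by (auto simp: halve_def valid_box_def box_refines_def box_supp_def)
    define small where
      "small n E s = {f \<in> Baire1 X. \<forall>x\<in>E - box_supp s. f x \<in> ball 0 (1 / Suc n)}"
      for n :: nat and E and s :: "'a box"
    define step where "step n E s =
      (SOME t. valid_box X t \<and> box_refines s t \<and> box_set X t \<subseteq> U n \<inter> small n E s)" for n E s
    have step: "valid_box X (step n E s) \<and> box_refines s (step n E s) \<and>
        box_set X (step n E s) \<subseteq> U n \<inter> small n E s"
      if s: "valid_box X s" and E: "finite E" "E \<subseteq> topspace X" for n E s
      unfolding step_def
    proof (rule someI_ex, rule ex_refinement[OF s])
      have small: "openin (Baire1_space X) (small n E s)"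
        unfolding small_def using E by (intro openin_Baire1_box) auto
      then show "openin (Baire1_space X) (U n \<inter> small n E s)"
        using U(1) by (intro openin_Int)
      have F: "finite (box_supp s)" "box_supp s \<subseteq> topspace X" "snd (snd s) > 0"
        using s by (auto simp: valid_box_def)
      obtain f where f: "f \<in> Baire1 X"
        "\<And>x. x \<in> E \<union> box_supp s \<Longrightarrow> f x = (if x \<in> box_supp s then fst s x else 0)"
      proof (rule Baire1_interpolate[OF X, where p = "\<lambda>x. if x \<in> box_supp s then fst s x else 0"])
        show "finite (E \<union> box_supp s)" "E \<union> box_supp s \<subseteq> topspace X" using E F by auto
      qed blast
      have "f \<in> small n E s \<inter> box_set X s"
        using f F(3) by (simp add: small_def box_set_def nb_def)
      then have "U n \<inter> (small n E s \<inter> box_set X s) \<noteq> {}"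
        using U(2) openin_Int[OF small openin_box_set[OF s]] by blast
      then show "U n \<inter> small n E s \<inter> box_set X s \<noteq> {}" by blast
    qed
    \<comment> \<open>By \<open>cong\<close> below, \<open>st n a\<close> depends on
      \<open>a \<inter> {..<n}\<close> only, so finitely many sets \<open>a\<close> account for all
      boxes of stage \<open>n\<close> and \<open>E n\<close> is finite.\<close>
    define points :: "(nat set \<Rightarrow> 'a box) \<Rightarrow> nat \<Rightarrow> 'a set" where
      "points t n = (\<Union>a\<in>Pow {..<n}. box_supp (t a))" for t n
    \<comment> \<open>All branches \<open>a\<close> are built at once: the sets \<open>M n\<close>
      handed to the \<kappa>-property depend on all of them, and \<open>A\<close> is known only
      afterwards.\<close>
    define st where "st = rec_nat (\<lambda>a. s0)
      (\<lambda>n t a. if n \<in> a then step n (points t n) (t a) else halve (t a))"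
    define E where "E n = points (st n) n" for n
    have st_0: "st 0 a = s0" for a by (simp add: st_def)
    have st_Suc: "st (Suc n) a = (if n \<in> a then step n (E n) (st n a) else halve (st n a))" for n a
      by (simp add: st_def E_def)
    have valid: "valid_box X (st n a)" for n a
    proof (induction n arbitrary: a)
      case (Suc n)
      have "finite (E n)" "E n \<subseteq> topspace X"
        using Suc by (auto simp: E_def points_def valid_box_def)
      then show ?case using Suc step halve by (auto simp: st_Suc)
    qed (simp add: st_0 s0)
    have finE: "finite (E n)" and subE: "E n \<subseteq> topspace X" for n
      using valid by (auto simp: E_def points_def valid_box_def)
    have ref: "box_refines (st n a) (st (Suc n) a)" for n a
      using step[OF valid finE subE] halve[OF valid] by (auto simp: st_Suc)
    have entered: "box_set X (st (Suc n) a) \<subseteq> U n \<inter> small n (E n) (st n a)" if "n \<in> a" for n a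
      using step[OF valid finE subE] that by (simp add: st_Suc)
    have cong: "st n (a \<inter> {..<n}) = st n a" for n a
    proof -
      \<comment> \<open>Allowing every \<open>m \<ge> n\<close> lets the induction on
        \<open>n\<close> keep \<open>m\<close> fixed.\<close>
      have "st n (a \<inter> {..<m}) = st n a" if "n \<le> m" for m
        using that by (induction n) (auto simp: st_0 st_Suc)
      then show ?thesis by simp
    qed
    have suppE: "box_supp (st n a) \<subseteq> E n" for n a
    proof -
      have "box_supp (st n (a \<inter> {..<n})) \<subseteq> E n" by (auto simp: E_def points_def)
      then show ?thesis by (simp only: cong)
    qed
    have E_Suc: "E n \<subseteq> E (Suc n)" for n
    proof
      fix x assume "x \<in> E n"
      then obtain a where a: "a \<subseteq> {..<n}" "x \<in> box_supp (st n a)"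
        by (auto simp: E_def points_def)
      have "x \<in> box_supp (st (Suc n) a)" using ref a(2) by (auto simp: box_refines_def)
      then show "x \<in> E (Suc n)" using suppE by blast
    qed
    have E_mono: "E m \<subseteq> E n" if "m \<le> n" for m n
      using E_Suc that by (rule lift_Suc_mono_le)
    \<comment> \<open>The points that some branch constrains for the first time at stage
      \<open>n\<close>.\<close>
    define M where "M n = E (Suc n) - E n" for n
    have disj: "M m \<inter> M n = {}" if "m < n" for m n
      using E_mono[of "Suc m" n] that by (auto simp: M_def)
    have "disjoint_family M"
      unfolding disjoint_family_on_def
      using disj by (metis Int_commute linorder_neqE_nat)
    then obtain A where A: "infinite A" "gdelta_in X (\<Union>n\<in>A. M n)"
      using \<kappa> finE subE unfolding kappa_set_def M_def
      by (metis (no_types, lifting) Diff_subset finite_Diff subset_trans)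
    obtain g where g: "\<And>n f. f \<in> Baire1 X \<Longrightarrow> (\<And>x. x \<in> box_supp (st n A) \<Longrightarrow> f x = g x) \<Longrightarrow>
        f \<in> box_set X (st n A)"
      using box_refines_limit[where s = "\<lambda>n. st n A", OF valid ref] by metis
    define D where "D = (\<Union>n\<in>A. M n)"
    define Z where "Z = (\<Union>n. box_supp (st n A))"
    have bound: "\<bar>g x\<bar> < 1 / Suc n" if n: "n \<in> A" and x: "x \<in> box_supp (st (Suc n) A)"
      "x \<in> E n" "x \<notin> box_supp (st n A)" for n x
    proof -
      have "finite (box_supp (st (Suc n) A))" "box_supp (st (Suc n) A) \<subseteq> topspace X"
        using valid[of "Suc n" A] by (auto simp: valid_box_def)
      \<comment> \<open>Since \<open>g\<close> itself need not be of the first class, the bound is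
        read off from an interpolating function that lies in the box.\<close>
      then obtain h where h: "h \<in> Baire1 X" "\<And>y. y \<in> box_supp (st (Suc n) A) \<Longrightarrow> h y = g y"
        using Baire1_interpolate[OF X] by metis
      have "h \<in> small n (E n) (st n A)" using g[OF h] entered[OF n] by blast
      then have "h x \<in> ball 0 (1 / Suc n)" using x unfolding small_def by blast
      then show ?thesis using h(2)[OF x(1)] by simp
    qed
    \<comment> \<open>A point off \<open>D\<close> joins the support of branch \<open>A\<close> at
      the start, or at a stage \<open>j \<in> A\<close> when it already is in \<open>E j\<close>. In
      the latter case \<open>bound\<close> forces \<open>j < m\<close>; either way the point is in
      \<open>E m\<close>.\<close>
    have small_off_D: "x \<in> E m" if x: "x \<in> Z" "x \<notin> D" "1 / Suc m \<le> \<bar>g x\<bar>" for x and m :: nat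
    proof -
      define n where "n = (LEAST n. x \<in> box_supp (st n A))"
      have ex: "\<exists>n. x \<in> box_supp (st n A)" using x(1) by (auto simp: Z_def)
      then have n: "x \<in> box_supp (st n A)" unfolding n_def by (rule LeastI_ex)
      show ?thesis
      proof (cases n)
        case 0
        then show ?thesis using n suppE E_mono[of 0 m] by blast
      next
        case (Suc j)
        then have j: "x \<notin> box_supp (st j A)" using not_less_Least[of j "\<lambda>n. x \<in> box_supp (st n A)"]
          by (auto simp: n_def)
        then have "j \<in> A" using n Suc by (auto simp: st_Suc supp_halve split: if_splits)
        moreover have "x \<in> E j"
          using n Suc suppE x(2) \<open>j \<in> A\<close> by (auto simp: D_def M_def)
        ultimately have "\<bar>g x\<bar> < 1 / Suc j" using bound n Suc j by blast
        then have "1 / real (Suc m) < 1 / real (Suc j)" using x(3) by linarith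
        then have "j \<le> m" by (simp add: field_simps)
        then show ?thesis using \<open>x \<in> E j\<close> E_mono by blast
      qed
    qed
    have "countable (M n)" for n
      unfolding M_def by (intro countable_finite finite_Diff finE)
    then have D: "countable D" "D \<subseteq> topspace X"
      using subE by (auto simp: D_def M_def)
    define f where "f x = (if x \<in> Z then g x else 0)" for x
    \<comment> \<open>On \<open>D\<close> the values are arbitrary, but \<open>D\<close> is a
      countable \<open>G\<^sub>\<delta>\<close>-set; off \<open>D\<close> the function vanishes at
      infinity by \<open>small_off_D\<close>.\<close>
    have "baire_one X (\<lambda>x. (if x \<in> D then f x else 0) + (if x \<in> D then 0 else f x))"
    proof (rule baire_one_add)
      show "baire_one X (\<lambda>x. if x \<in> D then f x else 0)"
        by (rule baire_one_countable_support[OF X, of D]) (use A(2) D in \<open>auto simp: D_def\<close>)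
      show "baire_one X (\<lambda>x. if x \<in> D then 0 else f x)"
      proof (rule baire_one_vanishing_at_infinity[OF X])
        fix m :: nat
        have "{x \<in> topspace X. 1 / Suc m \<le> \<bar>if x \<in> D then 0 else f x\<bar>} \<subseteq> E m"
          using small_off_D by (auto simp: f_def split: if_splits)
        then show "finite {x \<in> topspace X. 1 / Suc m \<le> \<bar>if x \<in> D then 0 else f x\<bar>}"
          by (rule finite_subset) (rule finE)
      qed
    qed
    moreover have "(\<lambda>x. (if x \<in> D then f x else 0) + (if x \<in> D then 0 else f x)) = f" by auto
    ultimately have f: "restrict f (topspace X) \<in> Baire1 X" by (simp add: restrict_in_Baire1)
    have in_box: "restrict f (topspace X) \<in> box_set X (st n A)" for n
    proof (rule g[OF f])
      fix x assume x: "x \<in> box_supp (st n A)"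
      then have "x \<in> topspace X" using suppE subE by blast
      then show "restrict f (topspace X) x = g x" using x by (auto simp: f_def Z_def)
    qed
    have "restrict f (topspace X) \<in> U0 k" for k
    proof -
      obtain n where n: "n \<in> A" "n \<ge> k"
        using A(1) unfolding infinite_nat_iff_unbounded_le by blast
      then have "restrict f (topspace X) \<in> U n" using in_box[of "Suc n"] entered[OF n(1)] by blast
      then show ?thesis using n(2) by (auto simp: U_def)
    qed
    moreover have "restrict f (topspace X) \<in> W" using in_box[of 0] s0(2) by (auto simp: st_0)
    ultimately show "(\<Inter>n. U0 n) \<inter> W \<noteq> {}" by blast
  qed
qed

theorem theorem4p2:
  fixes X :: "'a topology"
  assumes "separable_space X" and "metrizable_space X"
  shows "(Polish_space (Baire1_space X) \<longleftrightarrow> countable (topspace X)) \<and>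
    (complete_function_space (topspace X) (Baire1_space X) \<longleftrightarrow> Q_set X) \<and>
    (complete_function_space (topspace X) (Baire1_space X) \<longleftrightarrow>
       Baire1 X = (topspace X \<rightarrow>\<^sub>E UNIV)) \<and>
    (sequentially_complete_function_space (topspace X) (Baire1_space X) \<longleftrightarrow> sigma_set X) \<and>
    (Choquet_space (Baire1_space X) \<longleftrightarrow> lambda_set X) \<and>
    (Baire_space (Baire1_space X) \<longleftrightarrow> kappa_set X)"
proof -
  have "complete_function_space (topspace X) (Baire1_space X) \<longleftrightarrow>
      Baire1 X = (topspace X \<rightarrow>\<^sub>E UNIV)"
    using complete_imp_full[OF assms(2)] full_imp_complete by blast
  then show ?thesis
    using Polish_iff_countable[OF assms(2)] full_iff_Q_set[OF assms(2)]
      sequentially_complete_iff_sigma_set[OF assms(2)]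
      lambda_set_imp_Choquet[OF assms(2)] Choquet_imp_lambda_set[OF assms(2)]
      kappa_set_imp_Baire[OF assms(2)] Baire_imp_kappa_set[OF assms(2)]
    by blast
qed

end
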